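(* Let $G=(V,E)$ be a simple, connected, non-bipartite graph with edge ideal $I_G$, and let $U\subset V$. Then $\mathfrak m^{\mathbf 1_U}\in \mathrm{Ass}(I_G^{\mathrm{astab}(I_G)})$ if and only if $Z:=V\setminus U$ is a coclique set and either $U=N(Z)$, or $U\neq N(Z)$ and every connected component of $G_{U\setminus N(Z)}$ contains an odd cycle.
   Context: Graphs are finite. Write $V=\{P_1,\dots,P_d\}$ and $R=K[x_1,\dots,x_d]$ with $K$ a field. The edge ideal of $G$ is $I_G=(x_ix_j : P_iP_j\in E)\subset R$. For $U\subset V$, $\mathfrak m^{\mathbf 1_U}$ denotes the prime ideal generated by the variables $x_i$ with $P_i\in U$, and $G_U$ is the subgraph of $G$ induced on $U$. $\mathrm{Ass}(J)$ denotes the set of associated primes of $R/J$. A coclique set is an independent set of vertices (possibly empty). For $S\subset V$, $N(S)$ is the set of vertices of $G$ adjacent to at least one vertex of $S$. $\mathrm{astab}(I_G)$ is the smallest $k\ge 1$ such that $\mathrm{Ass}(I_G^k)=\mathrm{Ass}(I_G^{k+i})$ for all $i\ge 0$. *)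

theory Defs
  imports
    "HOL-Library.Poly_Mapping"
    "HOL-Algebra.Ideal_Product"
    "HOL-Algebra.Algebraic_Closure_Type"
    "Graph_Theory.Digraph_Component"
    "Graph_Theory.Pair_Digraph"
begin

section \<open>Associated primes of powers of an ideal\<close>

text \<open>The annihilator of the class of \<open>f\<close> in the module \<open>R/J\<close> is \<open>{r. r f \<in> J}\<close>.\<close>

definition ass_primes :: "('a, 'b) ring_scheme \<Rightarrow> 'a set \<Rightarrow> 'a set set" where
  "ass_primes R J =
     {P. primeideal P R \<and> (\<exists>f \<in> carrier R. P = {r \<in> carrier R. r \<otimes>\<^bsub>R\<^esub> f \<in> J})}"

text \<open>\<^const>\<open>ideals_set\<close> is the semiring of ideals, whose unit is the whole ring.\<close>

abbreviation ideal_power :: "('a, 'b) ring_scheme \<Rightarrow> 'a set \<Rightarrow> nat \<Rightarrow> 'a set" where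
  "ideal_power R I k \<equiv> I [^]\<^bsub>ideals_set R\<^esub> k"

text \<open>For a Noetherian ring such a \<open>k\<close> exists by Brodmann's theorem, so that \<open>LEAST\<close> is meaningful.\<close>

definition astab :: "('a, 'b) ring_scheme \<Rightarrow> 'a set \<Rightarrow> nat" where
  "astab R I = (LEAST k. 1 \<le> k \<and>
     (\<forall>i. ass_primes R (ideal_power R I k) = ass_primes R (ideal_power R I (k + i))))"

section \<open>The polynomial ring on the vertices\<close>

text \<open>Finitely supported exponent vectors are mapped to coefficients; for \<open>'v\<close> finite this is the
  polynomial ring over \<open>'k\<close> with one variable for each element of \<open>'v\<close>.\<close>

type_synonym ('v, 'k) mpoly = "('v \<Rightarrow>\<^sub>0 nat) \<Rightarrow>\<^sub>0 'k"

abbreviation mpoly_ring :: "('v, 'k::field) mpoly ring" where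
  "mpoly_ring \<equiv> ring_of_type_algebra"

definition var :: "'v \<Rightarrow> ('v, 'k::field) mpoly" where
  "var v = Poly_Mapping.single (Poly_Mapping.single v 1) 1"

definition var_prime :: "'v set \<Rightarrow> ('v, 'k::field) mpoly set" where
  "var_prime U = Idl\<^bsub>mpoly_ring\<^esub> (var ` U)"

section \<open>Graphs\<close>

text \<open>A finite simple graph is a \<^const>\<open>pair_graph\<close>: a finite loopfree digraph without parallel arcs
  and with a symmetric arc relation, so each edge is represented by its two orientations.\<close>

definition edge_ideal :: "'v pair_pre_digraph \<Rightarrow> ('v, 'k::field) mpoly set" where
  "edge_ideal G = Idl\<^bsub>mpoly_ring\<^esub> {var u * var v | u v. (u, v) \<in> parcs G}"

definition bipartite :: "'v pair_pre_digraph \<Rightarrow> bool" where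
  "bipartite G \<longleftrightarrow> (\<exists>A B. A \<union> B = pverts G \<and> A \<inter> B = {} \<and>
     (\<forall>(u, v) \<in> parcs G. (u \<in> A \<and> v \<in> B) \<or> (u \<in> B \<and> v \<in> A)))"

definition coclique :: "'v pair_pre_digraph \<Rightarrow> 'v set \<Rightarrow> bool" where
  "coclique G S \<longleftrightarrow> S \<subseteq> pverts G \<and> (\<forall>u \<in> S. \<forall>v \<in> S. (u, v) \<notin> parcs G)"

definition nbhd :: "'v pair_pre_digraph \<Rightarrow> 'v set \<Rightarrow> 'v set" where
  "nbhd G S = {v \<in> pverts G. \<exists>u \<in> S. (u, v) \<in> parcs G}"

definition components :: "('v, 'e) pre_digraph \<Rightarrow> ('v, 'e) pre_digraph set" where
  "components H = {C. pre_digraph.max_subgraph H Digraph_Component.connected C}"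

text \<open>In a symmetric digraph a directed 2-cycle may be a single edge; in a loopfree one, an odd
  directed cycle has length at least 3, so it is an odd cycle of the undirected graph.\<close>

definition has_odd_cycle :: "('v, 'e) pre_digraph \<Rightarrow> bool" where
  "has_odd_cycle H \<longleftrightarrow> (\<exists>p. pre_digraph.cycle H p \<and> odd (length p))"

end

theory Submission
  imports Defs
begin

text \<open>A monomial \<open>x\<^sup>a\<close> lies in \<open>I\<^sup>k\<close> iff \<open>a\<close> dominates the degree vector of a multiset of \<open>k\<close>
  edges, and the prime \<open>P\<^sub>U\<close> generated by the variables in \<open>U\<close> is associated to \<open>I\<^sup>k\<close> iff for some \<open>a\<close> the number \<open>k\<close> is not
  reached by raising \<open>a\<close> outside \<open>U\<close>, but is reached by raising \<open>a\<close> at any one vertex of \<open>U\<close>.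
  Raising \<open>a\<close> on \<open>Z\<close> lets every vertex of \<open>N(Z)\<close> be matched into \<open>Z\<close>, so only the components of
  \<open>U - N(Z)\<close> matter. If such a component were bipartite, a maximum multiset of edges would have to use
  up \<open>a\<close> on one side of it, since otherwise the union with a larger multiset for the raised vector
  splits into two halves, one of which is too large for \<open>a\<close>; but then raising \<open>a\<close> on the other side
  has no effect. If every component has an odd cycle, odd walks provide a suitable \<open>a\<close> for all
  large \<open>k\<close>. As the necessary condition holds for every \<open>k\<close>, the sets of associated primes are
  eventually equal to the one described.\<close>

section \<open>Degree vectors of edge multisets\<close>

lemma sum_count_eq_size:
  assumes "finite S" "set_mset M \<subseteq> S"
  shows "(\<Sum>x\<in>S. count M x) = size M"
  unfolding size_multiset_overloaded_eq
  by (rule sum.mono_neutral_right) (use assms in \<open>auto simp: not_in_iff\<close>)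

text \<open>By induction on the number of edges: remove an edge with an end of odd degree, if there is one.
  If there is none, then after the removal of any edge only its two ends are unbalanced, and equally so, since the
  imbalances add up to the same number on both sides.\<close>

lemma bipartite_split:
  fixes H :: "('a \<times> 'b) multiset"
  shows "\<exists>H1 H2. H = H1 + H2 \<and>
    (\<forall>p. \<bar>int (count (image_mset fst H1) p) - int (count (image_mset fst H2) p)\<bar> \<le> 1) \<and>
    (\<forall>q. \<bar>int (count (image_mset snd H1) q) - int (count (image_mset snd H2) q)\<bar> \<le> 1)"
proof (induction "size H" arbitrary: H)
  case 0
  then show ?case by auto
next
  case (Suc n)
  define odd_edge where "odd_edge e \<longleftrightarrow> e \<in># H \<and>
    (odd (count (image_mset fst H) (fst e)) \<or> odd (count (image_mset snd H) (snd e)))" for e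
  obtain e where e: "e \<in># H" and odd_e: "(\<exists>e. odd_edge e) \<Longrightarrow> odd_edge e"
    using Suc(2) by (metis multiset_nonemptyE nat.distinct(1) odd_edge_def size_empty)
  obtain p q where pq: "e = (p, q)" by (cases e)
  obtain H' where H': "H = add_mset e H'" using e by (metis insert_DiffM)
  obtain H1 H2 where H12: "H' = H1 + H2"
    and bal1: "\<And>p. \<bar>int (count (image_mset fst H1) p) - int (count (image_mset fst H2) p)\<bar> \<le> 1"
    and bal2: "\<And>q. \<bar>int (count (image_mset snd H1) q) - int (count (image_mset snd H2) q)\<bar> \<le> 1"
    using Suc(1)[of H'] Suc(2) H' by auto
  define d1 where "d1 p = int (count (image_mset fst H1) p) - int (count (image_mset fst H2) p)" for p
  define d2 where "d2 q = int (count (image_mset snd H1) q) - int (count (image_mset snd H2) q)" for q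
  note bal = bal1[folded d1_def] bal2[folded d2_def]
  \<comment> \<open>An imbalance of at most 1 is determined, up to its sign, by the parity of the
    degree.\<close>
  have par: "odd (a + b) \<longleftrightarrow> int a - int b \<noteq> 0" if "\<bar>int a - int b\<bar> \<le> 1" for a b :: nat
    using that by presburger
  have par1: "odd (count (image_mset fst H') x) \<longleftrightarrow> d1 x \<noteq> 0" for x
    using par[OF bal1[of x]] by (simp add: d1_def H12)
  have par2: "odd (count (image_mset snd H') y) \<longleftrightarrow> d2 y \<noteq> 0" for y
    using par[OF bal2[of y]] by (simp add: d2_def H12)
  \<comment> \<open>The only obstacle to adding \<open>e\<close> to one of the two halves is that
    its ends are unbalanced in opposite directions.\<close>
  have same_sign: "\<not> (d1 p = 1 \<and> d2 q = -1) \<and> \<not> (d1 p = -1 \<and> d2 q = 1)"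
  proof (cases "odd_edge e")
    case True
    \<comment> \<open>Removing \<open>e\<close> makes the odd degree even, so that end is balanced
      in \<open>H'\<close>.\<close>
    then have "d1 p = 0 \<or> d2 q = 0"
      using par1[of p] par2[of q] by (auto simp: odd_edge_def pq H')
    then show ?thesis by auto
  next
    case False
    with odd_e have even: "\<not> odd_edge e'" for e' by blast
    have ev1: "even (count (image_mset fst H) x)" for x
    proof (cases "x \<in># image_mset fst H")
      case True
      then show ?thesis using even by (auto simp: odd_edge_def)
    next
      case False
      then show ?thesis by (simp only: not_in_iff) simp
    qed
    have ev2: "even (count (image_mset snd H) x)" for x
    proof (cases "x \<in># image_mset snd H")
      case True
      then show ?thesis using even by (auto simp: odd_edge_def)
    next
      case False
      then show ?thesis by (simp only: not_in_iff) simp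
    qed
    have z1: "d1 x = 0" if "x \<noteq> p" for x
      using par1[of x] ev1[of x] that by (auto simp: pq H')
    have z2: "d2 x = 0" if "x \<noteq> q" for x
      using par2[of x] ev2[of x] that by (auto simp: pq H')
    define S where "S = fst ` set_mset H"
    define T where "T = snd ` set_mset H"
    have ST: "finite S" "finite T" "p \<in> S" "q \<in> T" using e by (force simp: S_def T_def pq)+
    have "int (size H1) - int (size H2) = (\<Sum>x\<in>S. d1 x)"
    proof -
      have "set_mset (image_mset fst H1) \<subseteq> S" "set_mset (image_mset fst H2) \<subseteq> S"
        by (auto simp: S_def H' H12)
      then show ?thesis
        using ST by (simp add: d1_def sum_subtractf sum_count_eq_size flip: of_nat_sum)
    qed
    also have "\<dots> = d1 p"
      using ST z1 by (simp add: sum.remove[of S p])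
    finally have s1: "int (size H1) - int (size H2) = d1 p" .
    have "int (size H1) - int (size H2) = (\<Sum>x\<in>T. d2 x)"
    proof -
      have "set_mset (image_mset snd H1) \<subseteq> T" "set_mset (image_mset snd H2) \<subseteq> T"
        by (auto simp: T_def H' H12)
      then show ?thesis
        using ST by (simp add: d2_def sum_subtractf sum_count_eq_size flip: of_nat_sum)
    qed
    also have "\<dots> = d2 q"
      using ST z2 by (simp add: sum.remove[of T q])
    finally show ?thesis using s1 by simp
  qed
  have split: ?case if "H = K1 + K2"
    and "\<And>x. \<bar>int (count (image_mset fst K1) x) - int (count (image_mset fst K2) x)\<bar> \<le> 1"
    and "\<And>x. \<bar>int (count (image_mset snd K1) x) - int (count (image_mset snd K2) x)\<bar> \<le> 1" for K1 K2
    using that by blast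
  show ?case
  proof (cases "d1 p = 1 \<or> d2 q = 1")
    case True
    then have "d1 p \<in> {0, 1}" "d2 q \<in> {0, 1}"
      using same_sign bal(1)[of p] bal(2)[of q] by auto
    then show ?thesis
      using bal by (intro split[of H1 "add_mset e H2"]) (auto simp: H' H12 pq d1_def d2_def)
  next
    case False
    then have "d1 p \<in> {-1, 0}" "d2 q \<in> {-1, 0}"
      using bal(1)[of p] bal(2)[of q] by auto
    then show ?thesis
      using bal by (intro split[of "add_mset e H1" H2]) (auto simp: H' H12 pq d1_def d2_def)
  qed
qed

text \<open>If a maximum multiset \<open>F\<close> had slack at \<open>q\<close>, then
  \<open>F\<close> and a larger \<open>F'\<close> for the bounds raised at \<open>q\<close> would
  have \<open>2 * m + 1\<close> edges within twice the bounds, and the larger of two balanced halves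
  would contain \<open>Suc m\<close> edges within the bounds. So \<open>F\<close> exhausts
  \<open>d\<close> on \<open>B\<close>, and \<open>m\<close> is the total of \<open>d\<close> over
  \<open>B\<close>, which cannot be exceeded whatever the bounds \<open>c'\<close> are.\<close>

lemma bipartite_deficiency:
  fixes c :: "'a \<Rightarrow> nat" and d :: "'b \<Rightarrow> nat"
  assumes E: "E \<subseteq> UNIV \<times> B" and "finite B"
  defines "sub \<equiv> \<lambda>m c d. \<exists>F. set_mset F \<subseteq> E \<and> size F = m \<and>
    (\<forall>p. count (image_mset fst F) p \<le> c p) \<and> (\<forall>q. count (image_mset snd F) q \<le> d q)"
  assumes max: "sub m c d" "\<not> sub (Suc m) c d"
    and incr: "\<And>q. q \<in> B \<Longrightarrow> sub (Suc m) c (d(q := Suc (d q)))"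
  shows "\<not> sub (Suc m) c' d"
proof
  obtain F where F: "set_mset F \<subseteq> E" "size F = m"
    "\<And>p. count (image_mset fst F) p \<le> c p" "\<And>q. count (image_mset snd F) q \<le> d q"
    using max(1) unfolding sub_def by blast
  have sat: "count (image_mset snd F) q = d q" if q: "q \<in> B" for q
  proof (rule ccontr)
    assume "count (image_mset snd F) q \<noteq> d q"
    with F(4)[of q] have lt: "count (image_mset snd F) q < d q" by simp
    obtain F' where F': "set_mset F' \<subseteq> E" "size F' = Suc m"
      "\<And>p. count (image_mset fst F') p \<le> c p"
      "\<And>y. count (image_mset snd F') y \<le> (d(q := Suc (d q))) y"
      using incr[OF q] unfolding sub_def by blast
    obtain H1 H2 where H: "F + F' = H1 + H2"
      and b1: "\<And>p. \<bar>int (count (image_mset fst H1) p) - int (count (image_mset fst H2) p)\<bar> \<le> 1"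
      and b2: "\<And>q. \<bar>int (count (image_mset snd H1) q) - int (count (image_mset snd H2) q)\<bar> \<le> 1"
      using bipartite_split[of "F + F'"] by blast
    have c1: "count (image_mset fst H1) p + count (image_mset fst H2) p \<le> 2 * c p" for p
      using F(3)[of p] F'(3)[of p] arg_cong[OF H, of "\<lambda>M. count (image_mset fst M) p"]
      by simp
    \<comment> \<open>The slack of \<open>F\<close> at \<open>q\<close> absorbs the extra unit
      granted to \<open>F'\<close> there.\<close>
    have c2: "count (image_mset snd H1) y + count (image_mset snd H2) y \<le> 2 * d y" for y
      using F(4)[of y] F'(4)[of y] lt arg_cong[OF H, of "\<lambda>M. count (image_mset snd M) y"]
      by (simp split: if_splits)
    have sz: "size H1 + size H2 = Suc (2 * m)"
      using arg_cong[OF H, of size] F(2) F'(2) by simp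
    have sub: "set_mset H1 \<subseteq> E" "set_mset H2 \<subseteq> E"
      using arg_cong[OF H, of set_mset] F(1) F'(1) by auto
    \<comment> \<open>Two numbers that differ by at most 1 and add up to at most twice a bound both
      respect the bound.\<close>
    have fit: "count (image_mset fst H) p \<le> c p" "count (image_mset snd H) y \<le> d y"
      if "H = H1 \<or> H = H2" for H p y
      using that b1[of p] b2[of y] c1[of p] c2[of y] by (auto)
    obtain H where H: "H = H1 \<or> H = H2" and "Suc m \<le> size H"
    proof -
      have "Suc m \<le> size H1 \<or> Suc m \<le> size H2" using sz by linarith
      then show thesis using that by blast
    qed
    then obtain K where K: "K \<subseteq># H" "size K = Suc m"
    proof -
      obtain xs where xs: "H = mset xs" using ex_mset by metis
      show thesis
        using \<open>Suc m \<le> size H\<close> by (intro that[of "mset (take (Suc m) xs)"]) (simp_all add: xs,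
          metis append_take_drop_id mset_append mset_subset_eq_add_left)
    qed
    have "sub (Suc m) c d"
      unfolding sub_def
    proof (intro exI[of _ K] conjI allI K(2))
      show "set_mset K \<subseteq> E" using H sub set_mset_mono[OF K(1)] by auto
      show "count (image_mset fst K) p \<le> c p" for p
        using fit(1)[OF H] mset_subset_eq_count[OF image_mset_subseteq_mono[OF K(1)], of fst p] le_trans by blast
      show "count (image_mset snd K) p \<le> d p" for p
        using fit(2)[OF H] mset_subset_eq_count[OF image_mset_subseteq_mono[OF K(1)], of snd p] le_trans by blast
    qed
    with max(2) show False ..
  qed
  assume "sub (Suc m) c' d"
  then obtain F' where F': "set_mset F' \<subseteq> E" "size F' = Suc m" "\<And>q. count (image_mset snd F') q \<le> d q"
    unfolding sub_def by blast
  have "Suc m = (\<Sum>q\<in>B. count (image_mset snd F') q)"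
    using sum_count_eq_size[OF \<open>finite B\<close>, of "image_mset snd F'"] F' E by fastforce
  also have "\<dots> \<le> (\<Sum>q\<in>B. count (image_mset snd F) q)"
    using F'(3) sat by (intro sum_mono) simp
  also have "\<dots> = m"
    using sum_count_eq_size[OF \<open>finite B\<close>, of "image_mset snd F"] F E by fastforce
  finally show False by simp
qed


section \<open>Edges as ordered pairs, and degrees that ignore the orientation\<close>

definition edge_deg :: "('v \<times> 'v) multiset \<Rightarrow> 'v \<Rightarrow> nat" where
  "edge_deg F v = count (image_mset fst F) v + count (image_mset snd F) v"

text \<open>The product of some \<open>k\<close> edges divides the monomial with exponents \<open>c\<close>.\<close>

definition fits :: "('v \<times> 'v) set \<Rightarrow> nat \<Rightarrow> ('v \<Rightarrow> nat) \<Rightarrow> bool" where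
  "fits E k c \<longleftrightarrow> (\<exists>F. set_mset F \<subseteq> E \<and> size F = k \<and> (\<forall>v. edge_deg F v \<le> c v))"

lemma edge_deg_simps [simp]:
  "edge_deg {#} v = 0"
  "edge_deg (add_mset e F) v = of_bool (fst e = v) + of_bool (snd e = v) + edge_deg F v"
  "edge_deg (F + F') v = edge_deg F v + edge_deg F' v"
  by (auto simp: edge_deg_def)

lemma fitsI: "set_mset F \<subseteq> E \<Longrightarrow> (\<And>v. edge_deg F v \<le> c v) \<Longrightarrow> fits E (size F) c"
  by (auto simp: fits_def)

lemma fits_0 [simp]: "fits E 0 c"
  using fitsI[of "{#}"] by simp

lemma fits_mono: "fits E k c \<Longrightarrow> (\<And>v. c v \<le> c' v) \<Longrightarrow> fits E k c'"
  unfolding fits_def using le_trans by blast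

lemma fits_add:
  assumes "fits E j c" "fits E k d"
  shows "fits E (j + k) (\<lambda>v. c v + d v)"
proof -
  obtain F F' where "set_mset F \<subseteq> E" "size F = j" "\<And>v. edge_deg F v \<le> c v"
    "set_mset F' \<subseteq> E" "size F' = k" "\<And>v. edge_deg F' v \<le> d v"
    using assms by (auto simp: fits_def)
  then show ?thesis using fitsI[of "F + F'" E "\<lambda>v. c v + d v"] by (simp add: add_mono)
qed

lemma fits_Suc_D:
  assumes "fits E (Suc k) c"
  obtains e where "e \<in> E" "\<forall>v. of_bool (fst e = v) + of_bool (snd e = v) \<le> c v"
    "fits E k (\<lambda>v. c v - (of_bool (fst e = v) + of_bool (snd e = v)))"
proof -
  obtain F where F: "set_mset F \<subseteq> E" "size F = Suc k" "\<And>v. edge_deg F v \<le> c v"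
    using assms by (auto simp: fits_def)
  obtain e F' where [simp]: "F = add_mset e F'" using F(2) by (metis size_eq_Suc_imp_eq_union)
  have le: "of_bool (fst e = v) + of_bool (snd e = v) + edge_deg F' v \<le> c v" for v
    using F(3)[of v] by simp
  show thesis
  proof (rule that[of e])
    show "e \<in> E" using F by simp
    show "\<forall>v. of_bool (fst e = v) + of_bool (snd e = v) \<le> c v"
      by (intro allI add_leD1[OF le])
    have "edge_deg F' v \<le> c v - (of_bool (fst e = v) + of_bool (snd e = v))" for v
      using le[of v] by linarith
    then show "fits E k (\<lambda>v. c v - (of_bool (fst e = v) + of_bool (snd e = v)))"
      using fitsI[of F' E] F by simp
  qed
qed

lemma fits_le: "fits E k c \<Longrightarrow> j \<le> k \<Longrightarrow> fits E j c"
proof (induction k)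
  case (Suc k)
  obtain e where "fits E k (\<lambda>v. c v - (of_bool (fst e = v) + of_bool (snd e = v)))"
    using fits_Suc_D[OF Suc(2)] by metis
  then have "fits E k c" by (rule fits_mono) simp
  then show ?case using Suc by (cases "j = Suc k") auto
qed simp

text \<open>The handshake count restricted to \<open>S\<close>: it turns degree bounds into bounds
  on the number of edges that meet \<open>S\<close>.\<close>

lemma sum_edge_deg:
  assumes "finite S"
  shows "(\<Sum>v\<in>S. edge_deg F v) = (\<Sum>e\<in>#F. of_bool (fst e \<in> S) + of_bool (snd e \<in> S))"
proof (induction F)
  case (add e F)
  have "(\<Sum>v\<in>S. of_bool (x = v)) = (of_bool (x \<in> S) :: nat)" for x
    using assms by (simp add: of_bool_def)
  then show ?case using add by (simp add: sum.distrib)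
qed simp

text \<open>An edge that meets \<open>C\<close> but does not lie in \<open>C\<close> has an end in \<open>N\<close>, so its other end may be
  moved to \<open>Z\<close>.\<close>

lemma fits_split_component:
  assumes "fits E k c"
    and N: "\<And>n. n \<in> N \<Longrightarrow> \<exists>z\<in>Z. (n, z) \<in> E"
    and disj: "C \<inter> Z = {}" "C \<inter> N = {}"
    and C: "\<And>x y. (x, y) \<in> E \<Longrightarrow> x \<in> C \<Longrightarrow> y \<in> C \<union> N" "\<And>x y. (x, y) \<in> E \<Longrightarrow> y \<in> C \<Longrightarrow> x \<in> C \<union> N"
  shows "\<exists>i j b. i + j = k \<and> fits (Restr E C) i (\<lambda>v. if v \<in> C then c v else 0) \<and>
    fits E j (\<lambda>v. (if v \<in> C then 0 else c v) + b v) \<and> (\<forall>v. v \<notin> Z \<longrightarrow> b v = 0)"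
proof -
  \<comment> \<open>The induction is on \<open>F\<close>, with its own degrees in place of
    \<open>c\<close>; \<open>b\<close> collects the ends moved to \<open>Z\<close>.\<close>
  have split: "\<exists>F1 F2 b. set_mset F1 \<subseteq> E \<inter> C \<times> C \<and> set_mset F2 \<subseteq> E \<and> size F1 + size F2 = size F \<and>
      (\<forall>v. edge_deg F1 v \<le> (if v \<in> C then edge_deg F v else 0)) \<and>
      (\<forall>v. edge_deg F2 v \<le> (if v \<in> C then 0 else edge_deg F v) + b v) \<and> (\<forall>v. v \<notin> Z \<longrightarrow> b v = (0::nat))"
    if "set_mset F \<subseteq> E" for F
    using that
  proof (induction F)
    case empty
    show ?case by (intro exI[of _ "{#}"] exI[of _ "\<lambda>_. 0"]) simp
  next
    case (add e F)
    obtain x y where e: "e = (x, y)" by (cases e)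
    have eE: "(x, y) \<in> E" using add(2) e by simp
    obtain F1 F2 b where IH: "set_mset F1 \<subseteq> E \<inter> C \<times> C" "set_mset F2 \<subseteq> E"
      "size F1 + size F2 = size F" "\<And>v. edge_deg F1 v \<le> (if v \<in> C then edge_deg F v else 0)"
      "\<And>v. edge_deg F2 v \<le> (if v \<in> C then 0 else edge_deg F v) + b v" "\<And>v. v \<notin> Z \<Longrightarrow> b v = 0"
      using add by auto
    \<comment> \<open>The edge goes to \<open>F2\<close> as \<open>(n, z)\<close>: its end
      \<open>n\<close> is paid for by \<open>F\<close>, its end \<open>z\<close> by
      \<open>b\<close>.\<close>
    have move: ?case if n: "n \<in> N" "n = x \<or> n = y" for n
    proof -
      obtain z where z: "z \<in> Z" "(n, z) \<in> E" using N n by blast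
      have "n \<notin> C" using n disj by blast
      have "edge_deg (add_mset (n, z) F2) v
          \<le> (if v \<in> C then 0 else edge_deg (add_mset e F) v) + (b v + of_bool (z = v))" for v
        using IH(5)[of v] n \<open>n \<notin> C\<close> by (auto simp: e)
      moreover have "edge_deg F1 v \<le> (if v \<in> C then edge_deg (add_mset e F) v else 0)" for v
        using IH(4)[of v] by (auto split: if_splits)
      moreover have "size F1 + size (add_mset (n, z) F2) = size (add_mset e F)"
        "set_mset (add_mset (n, z) F2) \<subseteq> E" "\<forall>v. v \<notin> Z \<longrightarrow> b v + of_bool (z = v) = 0"
        using IH z by auto
      ultimately show ?thesis
        using IH(1) by (intro exI[of _ F1] exI[of _ "add_mset (n, z) F2"] exI[of _ "\<lambda>v. b v + of_bool (z = v)"]) blast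
    qed
    consider "x \<in> N" | "y \<in> N" | "x \<in> C" "y \<in> C" | "x \<notin> C" "y \<notin> C"
      using C eE by blast
    then show ?case
    proof cases
      case 3
      have "edge_deg (add_mset e F1) v \<le> (if v \<in> C then edge_deg (add_mset e F) v else 0)" for v
        using IH(4)[of v] 3 by (auto simp: e split: if_splits)
      moreover have "edge_deg F2 v \<le> (if v \<in> C then 0 else edge_deg (add_mset e F) v) + b v" for v
        using IH(5)[of v] by (auto split: if_splits)
      moreover have "set_mset (add_mset e F1) \<subseteq> E \<inter> C \<times> C"
        "size (add_mset e F1) + size F2 = size (add_mset e F)"
        using IH 3 eE e by auto
      ultimately show ?thesis
        using IH(2,6) by (intro exI[of _ "add_mset e F1"] exI[of _ F2] exI[of _ b]) blast
    next
      case 4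
      have "edge_deg (add_mset e F2) v \<le> (if v \<in> C then 0 else edge_deg (add_mset e F) v) + b v" for v
        using IH(5)[of v] 4 by (auto simp: e split: if_splits)
      moreover have "edge_deg F1 v \<le> (if v \<in> C then edge_deg (add_mset e F) v else 0)" for v
        using IH(4)[of v] by (auto split: if_splits)
      moreover have "set_mset (add_mset e F2) \<subseteq> E"
        "size F1 + size (add_mset e F2) = size (add_mset e F)"
        using IH eE e by auto
      ultimately show ?thesis
        using IH(1,6) by (intro exI[of _ F1] exI[of _ "add_mset e F2"] exI[of _ b]) blast
    qed (use move in auto)
  qed
  obtain F where F: "set_mset F \<subseteq> E" "size F = k" "\<And>v. edge_deg F v \<le> c v"
    using assms(1) by (auto simp: fits_def)
  obtain F1 F2 b where *: "set_mset F1 \<subseteq> E \<inter> C \<times> C" "set_mset F2 \<subseteq> E"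
    "size F1 + size F2 = size F" "\<And>v. edge_deg F1 v \<le> (if v \<in> C then edge_deg F v else 0)"
    "\<And>v. edge_deg F2 v \<le> (if v \<in> C then 0 else edge_deg F v) + b v" "\<And>v. v \<notin> Z \<Longrightarrow> b v = 0"
    using split[OF F(1)] by (elim exE conjE) blast
  show ?thesis
  proof (rule exI[of _ "size F1"], rule exI[of _ "size F2"], rule exI[of _ b], intro conjI)
    show "fits (E \<inter> C \<times> C) (size F1) (\<lambda>v. if v \<in> C then c v else 0)"
    proof (rule fitsI)
      show "edge_deg F1 v \<le> (if v \<in> C then c v else 0)" for v
        using *(4)[of v] F(3)[of v] by (auto split: if_splits)
    qed (use * in simp)
    have "edge_deg F2 v \<le> (if v \<in> C then 0 else c v) + b v" for v
      using *(5)[of v] F(3)[of v] by (auto split: if_splits)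
    then show "fits E (size F2) (\<lambda>v. (if v \<in> C then 0 else c v) + b v)"
      using *(2) by (intro fitsI)
  qed (use * F in auto)
qed

lemma fits_subset: "fits E k c \<Longrightarrow> E \<subseteq> E' \<Longrightarrow> fits E' k c"
  unfolding fits_def by blast

text \<open>Turning every edge so that it runs from \<open>A\<close> to \<open>B\<close> keeps all
  degrees, and as \<open>A\<close> and \<open>B\<close> are disjoint, each vertex then occurs in one
  coordinate only. The degree bound becomes a pair of bounds, as in
  \<open>bipartite_deficiency\<close>.\<close>

lemma fits_orient:
  fixes E :: "('v \<times> 'v) set"
  assumes "sym E" and AB: "A \<inter> B = {}" and E: "E \<subseteq> A \<times> B \<union> B \<times> A"
  shows "fits E k c \<longleftrightarrow> (\<exists>F. set_mset F \<subseteq> E \<inter> A \<times> B \<and> size F = k \<and>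
    (\<forall>v. count (image_mset fst F) v \<le> (if v \<in> A then c v else 0)) \<and>
    (\<forall>v. count (image_mset snd F) v \<le> (if v \<in> B then c v else 0)))" (is "_ \<longleftrightarrow> ?rhs")
proof
  assume "fits E k c"
  then obtain F where F: "set_mset F \<subseteq> E" "size F = k" "\<And>v. edge_deg F v \<le> c v"
    by (auto simp: fits_def)
  define F' where "F' = image_mset (\<lambda>(x, y). if x \<in> A then (x, y) else (y, x)) F"
  have "set_mset F' \<subseteq> E \<inter> A \<times> B"
    using F(1) E AB \<open>sym E\<close> unfolding F'_def by (fastforce split: if_splits dest: symD)
  then have "count (image_mset fst F') v = 0" if "v \<notin> A" for v
    using that unfolding count_eq_zero_iff by auto
  moreover have "count (image_mset snd F') v = 0" if "v \<notin> B" for v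
    using that \<open>set_mset F' \<subseteq> _\<close> unfolding count_eq_zero_iff by auto
  moreover have "edge_deg F' v = edge_deg F v" for v
    unfolding F'_def by (induction F) (auto split: if_splits)
  then have "edge_deg F' v \<le> c v" for v
    using F(3)[of v] by simp
  then have "count (image_mset fst F') v \<le> c v" "count (image_mset snd F') v \<le> c v" for v
    unfolding edge_deg_def by (meson add_leE)+
  ultimately have "count (image_mset fst F') v \<le> (if v \<in> A then c v else 0)"
    "count (image_mset snd F') v \<le> (if v \<in> B then c v else 0)" for v
    by simp_all
  then show ?rhs
    using \<open>set_mset F' \<subseteq> _\<close> F(2) by (intro exI[of _ F']) (simp add: F'_def)
next
  assume ?rhs
  then obtain F where F: "set_mset F \<subseteq> E \<inter> A \<times> B" "size F = k"
    "\<And>v. count (image_mset fst F) v \<le> (if v \<in> A then c v else 0)"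
    "\<And>v. count (image_mset snd F) v \<le> (if v \<in> B then c v else 0)" by blast
  have "edge_deg F v \<le> c v" for v
    using F(3)[of v] F(4)[of v] AB by (auto simp: edge_deg_def split: if_splits)
  then show "fits E k c" using F fitsI[of F E c] by auto
qed

section \<open>Odd walks and the effect of raising an exponent vector\<close>

lemma relpow_sym: "sym R \<Longrightarrow> (x, y) \<in> R ^^ n \<Longrightarrow> (y, x) \<in> R ^^ n"
proof (induction n arbitrary: y)
  case (Suc n)
  then obtain z where "(x, z) \<in> R ^^ n" "(z, y) \<in> R" by auto
  then show ?case using Suc.IH[OF Suc(2)] Suc(2) by (meson relpow_Suc_I2 symD)
qed simp

text \<open>\<open>nofit\<close> and \<open>fit\<close> express that the prime of \<open>U\<close>
  is associated to the \<open>k\<close>-th power, and \<open>W\<close> is \<open>U - N(Z)\<close>.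
  Without an odd closed walk at \<open>w\<close>, its component \<open>C\<close> in \<open>W\<close>
  is bipartite, with sides \<open>A\<close> and \<open>B\<close> given by the parity of walks from
  \<open>w\<close>. Raising the vector at any vertex of \<open>C\<close> would have to increase the
  maximum for \<open>C\<close>, which \<open>bipartite_deficiency\<close> rules out at
  \<open>w\<close>.\<close>

lemma odd_closed_walk_if_increments:
  fixes E :: "('v::finite \<times> 'v) set" and a :: "'v \<Rightarrow> nat"
  assumes "sym E" and W_def: "W = U - E `` (- U)"
    and nofit: "\<And>b. (\<And>u. u \<in> U \<Longrightarrow> b u = 0) \<Longrightarrow> \<not> fits E k (\<lambda>v. a v + b v)"
    and fit: "\<And>u. u \<in> U \<Longrightarrow> fits E k (a(u := Suc (a u)))"
    and w: "w \<in> W"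
  shows "\<exists>n. odd n \<and> (w, w) \<in> (Restr E W) ^^ n"
proof (rule ccontr)
  assume no_odd: "\<not> ?thesis"
  let ?EW = "Restr E W"
  have "sym ?EW" using \<open>sym E\<close> by (auto simp: sym_def)
  define A where "A = {x. \<exists>n. even n \<and> (w, x) \<in> ?EW ^^ n}"
  define B where "B = {x. \<exists>n. odd n \<and> (w, x) \<in> ?EW ^^ n}"
  define C where "C = A \<union> B"
  have "A \<inter> B = {}"
  proof (rule ccontr)
    assume "A \<inter> B \<noteq> {}"
    then obtain x m n where "even m" "(w, x) \<in> ?EW ^^ m" "odd n" "(w, x) \<in> ?EW ^^ n"
      by (auto simp: A_def B_def)
    then have "(w, w) \<in> ?EW ^^ (m + n)"
      unfolding relpow_add using relpow_sym[OF \<open>sym ?EW\<close>] by blast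
    then show False using no_odd \<open>even m\<close> \<open>odd n\<close> odd_add by blast
  qed
  have "w \<in> A" unfolding A_def by (intro CollectI exI[of _ "0 :: nat"]) simp
  have "x \<in> W" if "(w, x) \<in> ?EW ^^ n" for n x
    using that w by (cases n) auto
  then have CW: "C \<subseteq> W" by (auto simp: C_def A_def B_def)
  have stepA: "y \<in> B" if xy: "(x, y) \<in> ?EW" and x: "x \<in> A" for x y
  proof -
    obtain n where "(w, x) \<in> ?EW ^^ n" "even n" using x by (auto simp: A_def)
    then have "(w, y) \<in> ?EW ^^ Suc n" "odd (Suc n)" using xy by auto
    then show ?thesis unfolding B_def by blast
  qed
  have stepB: "y \<in> A" if xy: "(x, y) \<in> ?EW" and x: "x \<in> B" for x y
  proof -
    obtain n where "(w, x) \<in> ?EW ^^ n" "odd n" using x by (auto simp: B_def)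
    then have "(w, y) \<in> ?EW ^^ Suc n" "even (Suc n)" using xy by auto
    then show ?thesis unfolding A_def by blast
  qed
  \<comment> \<open>A vertex of \<open>C\<close> has no neighbour outside \<open>U\<close>, so an
    edge that leaves \<open>C\<close> ends in \<open>N(Z)\<close>.\<close>
  have out: "y \<in> C \<union> E `` (- U)" if "(x, y) \<in> E" "x \<in> C" for x y
  proof (cases "y \<in> W")
    case True
    then show ?thesis using that CW stepA stepB by (auto simp: C_def)
  next
    case False
    then show ?thesis using that CW \<open>sym E\<close> by (auto simp: W_def dest: symD)
  qed
  define EC where "EC = Restr E C"
  have "sym EC" using \<open>sym E\<close> by (auto simp: EC_def sym_def)
  have EC: "EC \<subseteq> A \<times> B \<union> B \<times> A"
    using stepA stepB CW unfolding EC_def C_def by blast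
  define c where "c v = (if v \<in> C then a v else 0)" for v
  have "\<not> fits EC k c"
  proof
    assume "fits EC k c"
    then have "fits E k (\<lambda>v. a v + 0)"
      by (rule fits_subset[OF fits_mono]) (auto simp: c_def EC_def)
    then show False using nofit[of "\<lambda>_. 0"] by simp
  qed
  \<comment> \<open>\<open>m\<close> is the largest number of edges inside \<open>C\<close> that
    \<open>c\<close> admits.\<close>
  then obtain m where m: "fits EC m c" "\<not> fits EC (Suc m) c"
    using ex_least_nat_less[of "\<lambda>i. \<not> fits EC i c" k] by auto
  \<comment> \<open>Of the \<open>k\<close> edges for the raised vector, \<open>i\<close> lie in
    \<open>C\<close>. If \<open>i\<close> were at most \<open>m\<close>, the unraised
    \<open>c\<close> would admit \<open>i\<close> edges in \<open>C\<close> as well; with the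
    \<open>j\<close> others they would be \<open>k\<close> edges below \<open>a + b\<close> with
    \<open>b\<close> zero on \<open>U\<close>, against \<open>nofit\<close>.\<close>
  have incr: "fits EC (Suc m) (c(u := Suc (c u)))" if "u \<in> C" for u
  proof -
    have "u \<in> U" using that CW by (auto simp: W_def)
    have "\<exists>i j b. i + j = k \<and>
      fits (Restr E C) i (\<lambda>v. if v \<in> C then (a(u := Suc (a u))) v else 0) \<and>
      fits E j (\<lambda>v. (if v \<in> C then 0 else (a(u := Suc (a u))) v) + b v) \<and> (\<forall>v. v \<notin> - U \<longrightarrow> b v = 0)"
    proof (rule fits_split_component[where N = "E `` (- U)"])
      show "fits E k (a(u := Suc (a u)))" by (rule fit[OF \<open>u \<in> U\<close>])
      show "\<exists>z\<in>- U. (n, z) \<in> E" if "n \<in> E `` (- U)" for n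
        using that \<open>sym E\<close> by (auto dest: symD)
      show "C \<inter> - U = {}" "C \<inter> E `` (- U) = {}" using CW by (auto simp: W_def)
      show "y \<in> C \<union> E `` (- U)" if "(x, y) \<in> E" "x \<in> C" for x y
        using that by (rule out)
      show "x \<in> C \<union> E `` (- U)" if "(x, y) \<in> E" "y \<in> C" for x y
        using that out symD[OF \<open>sym E\<close>] by blast
    qed
    then obtain i j b where ijb: "i + j = k \<and>
      fits (Restr E C) i (\<lambda>v. if v \<in> C then (a(u := Suc (a u))) v else 0) \<and>
      fits E j (\<lambda>v. (if v \<in> C then 0 else (a(u := Suc (a u))) v) + b v) \<and> (\<forall>v. v \<notin> - U \<longrightarrow> b v = 0)"
      by (elim exE) (rule that)
    note ij = ijb[THEN conjunct1] and i = ijb[THEN conjunct2, THEN conjunct1, folded EC_def]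
      and j = ijb[THEN conjunct2, THEN conjunct2, THEN conjunct1]
      and b = ijb[THEN conjunct2, THEN conjunct2, THEN conjunct2]
    have "Suc m \<le> i"
    proof (rule ccontr)
      assume "\<not> Suc m \<le> i"
      then have "fits E i c"
        by - (rule fits_subset[OF fits_le[OF m(1)]], auto simp: EC_def)
      from fits_add[OF this j] have "fits E k (\<lambda>v. a v + b v)"
        unfolding ij by (rule fits_mono) (use that in \<open>auto simp: c_def\<close>)
      then show False using nofit[of b] b by auto
    qed
    from fits_le[OF i this] show ?thesis
      by (rule fits_mono) (auto simp: c_def that)
  qed
  define A_part where "A_part c v = (if v \<in> A then c v else 0)" for c :: "'v \<Rightarrow> nat" and v
  define B_part where "B_part c v = (if v \<in> B then c v else 0)" for c :: "'v \<Rightarrow> nat" and v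
  define sub where "sub m c d \<longleftrightarrow> (\<exists>F. set_mset F \<subseteq> EC \<inter> A \<times> B \<and> size F = m \<and>
    (\<forall>v. count (image_mset fst F) v \<le> c v) \<and> (\<forall>v. count (image_mset snd F) v \<le> d v))"
    for m c d
  have orient: "fits EC i c \<longleftrightarrow> sub i (A_part c) (B_part c)" for i c
    unfolding sub_def A_part_def B_part_def by (rule fits_orient[OF \<open>sym EC\<close> \<open>A \<inter> B = {}\<close> EC])
  \<comment> \<open>Since \<open>w\<close> is in \<open>A\<close>, raising \<open>c\<close> at
    \<open>w\<close> changes only the bounds on the left, from which nothing can be gained.\<close>
  have "\<not> sub (Suc m) (A_part (c(w := Suc (c w)))) (B_part c)"
  proof (rule bipartite_deficiency[of "EC \<inter> A \<times> B" B, folded sub_def])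
    show "sub m (A_part c) (B_part c)" "\<not> sub (Suc m) (A_part c) (B_part c)"
      using m unfolding orient by auto
    show "sub (Suc m) (A_part c) ((B_part c)(q := Suc (B_part c q)))" if "q \<in> B" for q
    proof -
      have "A_part (c(q := Suc (c q))) = A_part c"
        "B_part (c(q := Suc (c q))) = (B_part c)(q := Suc (B_part c q))"
        using that \<open>A \<inter> B = {}\<close> by (auto simp: A_part_def B_part_def fun_eq_iff)
      then show ?thesis using incr[of q] that unfolding orient by (simp add: C_def)
    qed
  qed auto
  moreover have "B_part (c(w := Suc (c w))) = B_part c"
    using \<open>w \<in> A\<close> \<open>A \<inter> B = {}\<close> by (auto simp: B_part_def fun_eq_iff)
  ultimately show False
    using incr[of w] \<open>w \<in> A\<close> unfolding orient by (simp add: C_def)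
qed

text \<open>The edges of the walk go alternately to \<open>F\<close> and to \<open>L\<close>,
  beginning and ending with \<open>F\<close>. Inner visits count equally on both sides, and only the
  two ends are left over. Vertices and edges may repeat, and for \<open>x = y\<close> the surplus
  there is 2.\<close>

lemma odd_walk_alternating:
  assumes "(x, y) \<in> R ^^ n" "odd n"
  shows "\<exists>L F. set_mset L \<subseteq> R \<and> set_mset F \<subseteq> R \<and> size F = Suc (size L) \<and>
    (\<forall>v. edge_deg F v = edge_deg L v + of_bool (x = v) + of_bool (y = v))"
  using assms
proof (induction n arbitrary: x rule: less_induct)
  case (less n)
  show ?case
  proof (cases "n = 1")
    case True
    then show ?thesis using less(2) by (intro exI[of _ "{#}"] exI[of _ "{#(x, y)#}"]) auto
  next
    case False
    then obtain m where n: "n = Suc (Suc m)" "odd m"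
      using less(3) by (cases n; cases "n - 1") auto
    then obtain s t where st: "(x, s) \<in> R" "(s, t) \<in> R" "(t, y) \<in> R ^^ m"
      using less(2) by (meson relpow_Suc_D2)
    then obtain L F where "set_mset L \<subseteq> R" "set_mset F \<subseteq> R" "size F = Suc (size L)"
      "\<And>v. edge_deg F v = edge_deg L v + of_bool (t = v) + of_bool (y = v)"
      using less(1)[of m t] n by auto
    then show ?thesis
      using st by (intro exI[of _ "add_mset (s, t) L"] exI[of _ "add_mset (x, s) F"]) auto
  qed
qed

lemma count_image_mset_eq_sum: "count (image_mset g M) l = (\<Sum>e\<in>#M. of_bool (g e = l))"
  by (induction M) auto

text \<open>The exponent vector is \<open>1\<close> on the complement of \<open>U\<close> and on one representative of each component
  of \<open>W\<close>, plus the degrees of a multiset of edges that contains every second edge of an odd walk from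
  each vertex of \<open>W\<close> to the representative. Adding a vertex allows one to switch to the other edges
  of its walk, while parity bounds the number of edges in each component.\<close>

lemma increments_if_odd_closed_walks:
  fixes E :: "('v::finite \<times> 'v) set"
  assumes "sym E" "E \<noteq> {}" and coclique: "Restr E (- U) = {}" and W_def: "W = U - E `` (- U)"
    and odd_walk: "\<And>w. w \<in> W \<Longrightarrow> \<exists>n. odd n \<and> (w, w) \<in> (Restr E W) ^^ n"
  shows "\<exists>k0. \<forall>k\<ge>k0. \<exists>a. (\<forall>b. (\<forall>u\<in>U. b u = 0) \<longrightarrow> \<not> fits E k (\<lambda>v. a v + b v)) \<and>
    (\<forall>u\<in>U. fits E k (a(u := Suc (a u))))"
proof -
  define N where "N = E `` (- U)"
  define EW where "EW = Restr E W"
  have "sym EW" using \<open>sym E\<close> by (auto simp: EW_def sym_def)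
  then have "sym (EW\<^sup>*)" by (rule sym_rtrancl)
  have U: "U = N \<union> W" "N \<inter> W = {}" using coclique by (auto simp: N_def W_def)
  \<comment> \<open>The choice depends only on the set of vertices reachable from \<open>w\<close>,
    so it is the same throughout a component.\<close>
  define r where "r w = (SOME x. (w, x) \<in> EW\<^sup>*)" for w
  have r: "(w, r w) \<in> EW\<^sup>*" for w
    unfolding r_def by (rule someI[of _ w]) simp
  have r_eq: "r x = r y" if "(x, y) \<in> EW\<^sup>*" for x y
  proof -
    have "(x, z) \<in> EW\<^sup>* \<longleftrightarrow> (y, z) \<in> EW\<^sup>*" for z
      using that \<open>sym (EW\<^sup>*)\<close> by (meson rtrancl_trans symD)
    then show ?thesis by (simp add: r_def)
  qed
  have r_W: "r w \<in> W" if "w \<in> W" for w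
    using r[of w] that by (cases rule: rtranclE) (auto simp: EW_def)
  have r_idem: "r (r w) = r w" for w using r r_eq by metis
  have "\<exists>L F. set_mset L \<subseteq> EW \<and> set_mset F \<subseteq> EW \<and> size F = Suc (size L) \<and>
    (\<forall>v. edge_deg F v = edge_deg L v + of_bool (r w = v) + of_bool (w = v))" if "w \<in> W" for w
  proof -
    obtain n where n: "odd n" "(w, w) \<in> EW ^^ n" using odd_walk \<open>w \<in> W\<close> by (auto simp: EW_def)
    obtain m where m: "(r w, w) \<in> EW ^^ m"
      using r \<open>sym (EW\<^sup>*)\<close> by (meson rtrancl_imp_relpow symD)
    \<comment> \<open>If the walk from the representative is even, appending the odd closed walk at
      \<open>w\<close> corrects its parity.\<close>
    have "(r w, w) \<in> EW ^^ (m + n)" using n m unfolding relpow_add by blast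
    then show ?thesis
      using m n odd_walk_alternating[of "r w" w m EW] odd_walk_alternating[of "r w" w "m + n" EW]
      by (cases "odd m") auto
  qed
  then obtain L F where LF: "\<And>w. w \<in> W \<Longrightarrow> set_mset (L w) \<subseteq> EW \<and> set_mset (F w) \<subseteq> EW \<and>
    size (F w) = Suc (size (L w)) \<and>
    (\<forall>v. edge_deg (F w) v = edge_deg (L w) v + of_bool (r w = v) + of_bool (w = v))"
    by metis
  \<comment> \<open>\<open>e\<close> serves as padding, so that every large \<open>k\<close> is
    reached. It lies in \<open>W\<close> or joins \<open>Z\<close> to \<open>N(Z)\<close>; for these
    two types of edges the count below is exact.\<close>
  obtain e where e: "e \<in> EW \<union> E \<inter> (- U) \<times> N"
  proof (cases "W = {}")
    case True
    obtain x y where "(x, y) \<in> E" using \<open>E \<noteq> {}\<close> by auto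
    then have "x \<in> N \<or> y \<in> N" using coclique U True by auto
    then show thesis using that by (auto simp: N_def)
  next
    case False
    then obtain w n where "odd n" "(w, w) \<in> EW ^^ n" using odd_walk unfolding EW_def by blast
    then show thesis using that by (cases n) auto
  qed
  show ?thesis
  proof (intro exI[of _ "Suc (size (\<Sum>w\<in>W. L w))"] allI impI)
    fix k assume k: "Suc (size (\<Sum>w\<in>W. L w)) \<le> k"
    define M where "M = (\<Sum>w\<in>W. L w) + replicate_mset (k - Suc (size (\<Sum>w\<in>W. L w))) e"
    have k_eq: "k = Suc (size M)" using k by (simp add: M_def)
    have M: "set_mset M \<subseteq> EW \<union> E \<inter> (- U) \<times> N"
      using LF e by (auto simp: M_def set_mset_sum split: if_splits)
    have ME: "set_mset M \<subseteq> E" using M by (auto simp: EW_def)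
    define a where "a v = of_bool (v \<notin> U) + of_bool (v \<in> r ` W) + edge_deg M v" for v
    show "\<exists>a. (\<forall>b. (\<forall>u\<in>U. b u = 0) \<longrightarrow> \<not> fits E k (\<lambda>v. a v + b v)) \<and>
      (\<forall>u\<in>U. fits E k (a(u := Suc (a u))))"
    proof (intro exI[of _ a] conjI allI impI ballI notI)
      fix u assume "u \<in> U"
      then consider "u \<in> N" | "u \<in> W" using U by auto
      then show "fits E k (a(u := Suc (a u)))"
      proof cases
        case 1
        then obtain z where "z \<notin> U" "(z, u) \<in> E" by (auto simp: N_def)
        then show ?thesis
        proof -
          \<comment> \<open>The end \<open>z\<close> uses the unit of \<open>a\<close> outside
            \<open>U\<close>, the end \<open>u\<close> the increment.\<close>
          have "edge_deg (add_mset (z, u) M) v \<le> (a(u := Suc (a u))) v" for v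
            using \<open>z \<notin> U\<close> \<open>u \<in> U\<close> by (auto simp: a_def)
          then show ?thesis
            using ME \<open>(z, u) \<in> E\<close> fitsI[of "add_mset (z, u) M" E] by (simp add: k_eq)
        qed
      next
        case 2
        have "L u \<subseteq># M"
          using 2 by (simp add: M_def sum.remove[of W u] add.assoc)
        then obtain K where K: "M = L u + K" by (metis subset_mset.add_diff_inverse)
        \<comment> \<open>Replacing \<open>L u\<close> by \<open>F u\<close> gains one edge. It
          costs a unit at \<open>r u\<close>, which \<open>a\<close> provides, and a unit at
          \<open>u\<close>, which the increment provides.\<close>
        have "edge_deg (F u + K) v \<le> (a(u := Suc (a u))) v" for v
          using LF[OF 2] imageI[OF 2, of r] by (auto simp: a_def K)
        moreover have "set_mset (F u + K) \<subseteq> E" using LF[OF 2] ME by (auto simp: K EW_def)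
        moreover have "size (F u + K) = k" using LF[OF 2] by (simp add: k_eq K)
        ultimately show ?thesis using fitsI by blast
      qed
    next
      fix b assume b: "\<forall>u\<in>U. b u = (0::nat)" and "fits E k (\<lambda>v. a v + b v)"
      then obtain H where H: "set_mset H \<subseteq> E" "size H = k" "\<And>v. edge_deg H v \<le> a v + b v"
        by (auto simp: fits_def)
      \<comment> \<open>Edges are labelled \<open>None\<close> if they meet \<open>N(Z)\<close>, and
        by their component otherwise; for each label, \<open>H\<close> has no more edges than
        \<open>M\<close>.\<close>
      define g where "g e = (if fst e \<in> N \<or> snd e \<in> N then None else Some (r (fst e)))" for e
      have gW: "fst e \<in> W \<and> snd e \<in> W \<and> e \<in> EW \<and> r (fst e) = r (snd e)"
        if "e \<in> E" "g e = Some \<rho>" for e \<rho>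
      proof -
        have "fst e \<notin> N" "snd e \<notin> N" using that by (auto simp: g_def split: if_splits)
        then have "fst e \<in> U" "snd e \<in> U"
          using that(1) \<open>sym E\<close> by (cases e; auto simp: N_def dest: symD)+
        then have "fst e \<in> W" "snd e \<in> W" using U \<open>fst e \<notin> N\<close> \<open>snd e \<notin> N\<close> by auto
        then show ?thesis using that(1) r_eq[of "fst e" "snd e"] by (cases e) (auto simp: EW_def)
      qed
      have "count (image_mset g H) l \<le> count (image_mset g M) l" for l
      proof (cases l)
        case None
        \<comment> \<open>On \<open>N\<close> the bound \<open>a + b\<close> is the degree of
          \<open>M\<close>. Every edge of \<open>H\<close> labelled \<open>None\<close> has at least
          one end in \<open>N\<close>, and every such edge of \<open>M\<close> exactly one.\<close>
        have "count (image_mset g H) l \<le> (\<Sum>e\<in>#H. of_bool (fst e \<in> N) + of_bool (snd e \<in> N))"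
          unfolding count_image_mset_eq_sum None by (rule sum_mset_mono) (auto simp: g_def)
        also have "\<dots> = (\<Sum>v\<in>N. edge_deg H v)" by (simp add: sum_edge_deg)
        also have "\<dots> \<le> (\<Sum>v\<in>N. edge_deg M v)"
        proof (rule sum_mono)
          fix v assume "v \<in> N"
          then have "v \<in> U" "v \<notin> r ` W" using U r_W by auto
          then show "edge_deg H v \<le> edge_deg M v" using H(3)[of v] b by (simp add: a_def)
        qed
        also have "\<dots> = (\<Sum>e\<in>#M. of_bool (fst e \<in> N) + of_bool (snd e \<in> N))"
          by (simp add: sum_edge_deg)
        also have "\<dots> \<le> count (image_mset g M) l"
          unfolding count_image_mset_eq_sum None
        proof (rule sum_mset_mono)
          fix e assume "e \<in># M"
          then have "e \<in> EW \<or> fst e \<notin> U" using M by auto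
          then have "fst e \<in> N \<Longrightarrow> snd e \<notin> N" using U by (auto simp: EW_def)
          then show "of_bool (fst e \<in> N) + of_bool (snd e \<in> N) \<le> (of_bool (g e = None) :: nat)"
            by (auto simp: g_def)
        qed
        finally show ?thesis .
      next
        case (Some \<rho>)
        \<comment> \<open>Edges with this label have both ends in \<open>S\<close>, and the degree
          bound on \<open>S\<close> exceeds twice the count for \<open>M\<close> by at most the
          single unit at the representative; halving removes it.\<close>
        define S where "S = {v \<in> W. r v = \<rho>}"
        have "2 * count (image_mset g H) l \<le> (\<Sum>e\<in>#H. of_bool (fst e \<in> S) + of_bool (snd e \<in> S))"
          unfolding count_image_mset_eq_sum Some sum_mset_distrib_left
        proof (rule sum_mset_mono)
          fix e assume "e \<in># H"
          then show "2 * of_bool (g e = Some \<rho>) \<le> of_bool (fst e \<in> S) + (of_bool (snd e \<in> S) :: nat)"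
            using gW[of e \<rho>] H(1) by (cases "g e = Some \<rho>") (auto simp: S_def g_def split: if_splits)
        qed
        also have "\<dots> = (\<Sum>v\<in>S. edge_deg H v)" by (simp add: sum_edge_deg)
        also have "\<dots> \<le> (\<Sum>v\<in>S. of_bool (v \<in> r ` W) + edge_deg M v)"
        proof (rule sum_mono)
          fix v assume "v \<in> S"
          then have "v \<in> U" using U by (auto simp: S_def)
          then show "edge_deg H v \<le> of_bool (v \<in> r ` W) + edge_deg M v"
            using H(3)[of v] b by (simp add: a_def)
        qed
        also have "\<dots> = card (S \<inter> r ` W) + (\<Sum>v\<in>S. edge_deg M v)"
          by (simp add: sum.distrib)
        also have "card (S \<inter> r ` W) \<le> 1"
        proof -
          have "S \<inter> r ` W \<subseteq> {\<rho>}" using r_idem by (auto simp: S_def)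
          from card_mono[OF _ this] show ?thesis by simp
        qed
        also have "(\<Sum>v\<in>S. edge_deg M v) = (\<Sum>e\<in>#M. of_bool (fst e \<in> S) + of_bool (snd e \<in> S))"
          by (simp add: sum_edge_deg)
        also have "\<dots> \<le> 2 * count (image_mset g M) l"
          unfolding count_image_mset_eq_sum Some sum_mset_distrib_left
        proof (rule sum_mset_mono)
          fix e assume "e \<in># M"
          then consider "e \<in> EW" | "fst e \<notin> U" "snd e \<in> N" using M by auto
          then show "of_bool (fst e \<in> S) + of_bool (snd e \<in> S) \<le> 2 * (of_bool (g e = Some \<rho>) :: nat)"
          proof cases
            case 1
            then have "r (fst e) = r (snd e)" using r_eq by (cases e) auto
            then show ?thesis using 1 U by (auto simp: S_def g_def EW_def)
          qed (use U in \<open>auto simp: S_def\<close>)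
        qed
        finally show ?thesis by simp
      qed
      then have "image_mset g H \<subseteq># image_mset g M" by (rule mset_subset_eqI)
      then have "size H \<le> size M" using size_mset_mono by fastforce
      then show False using H(2) k_eq by simp
    qed
  qed
qed

section \<open>Products of polynomials\<close>

lemma mpoly_ring_simps [simp]:
  "carrier mpoly_ring = (UNIV :: ('v, 'k::field) mpoly set)"
  "f \<otimes>\<^bsub>mpoly_ring\<^esub> g = (f * g :: ('v, 'k) mpoly)"
  "f \<oplus>\<^bsub>mpoly_ring\<^esub> g = (f + g :: ('v, 'k) mpoly)"
  "\<one>\<^bsub>mpoly_ring\<^esub> = (1 :: ('v, 'k) mpoly)"
  "\<zero>\<^bsub>mpoly_ring\<^esub> = (0 :: ('v, 'k) mpoly)"
  by (simp_all add: ring_of_type_algebra_def)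

lemma cring_mpoly_ring: "cring (mpoly_ring :: ('v, 'k::field) mpoly ring)"
  by (rule cring_from_type_algebra)

lemma ring_mpoly_ring: "ring (mpoly_ring :: ('v, 'k::field) mpoly ring)"
  by (rule ring_from_type_algebra)

lemma ideal_mpoly_ringI:
  fixes J :: "('v, 'k::field) mpoly set"
  assumes "0 \<in> J" "\<And>f g. f \<in> J \<Longrightarrow> g \<in> J \<Longrightarrow> f + g \<in> J" "\<And>f g. f \<in> J \<Longrightarrow> g * f \<in> J"
  shows "ideal J mpoly_ring"
proof (rule idealI[OF ring_mpoly_ring])
  interpret R: ring "mpoly_ring :: ('v, 'k) mpoly ring" by (rule ring_mpoly_ring)
  have inv: "\<ominus>\<^bsub>mpoly_ring\<^esub> f = - f" for f :: "('v, 'k) mpoly"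
    by (rule R.minus_equality) simp_all
  have "- f \<in> J" if "f \<in> J" for f
    using assms(3)[OF that, of "- 1"] by simp
  then show "subgroup J (add_monoid mpoly_ring)"
    using assms inv by (intro R.add.subgroupI) (auto simp: a_inv_def)
  show "f \<otimes>\<^bsub>mpoly_ring\<^esub> g \<in> J" if "g \<in> J" for f g using assms that by simp
  show "g \<otimes>\<^bsub>mpoly_ring\<^esub> f \<in> J" if "g \<in> J" for f g
    using assms(3)[OF that, of f] by (simp add: mult.commute)
qed

lemma ideal_mpoly_ringD:
  assumes "ideal J (mpoly_ring :: ('v, 'k::field) mpoly ring)"
  shows "0 \<in> J" "f \<in> J \<Longrightarrow> g \<in> J \<Longrightarrow> f + g \<in> J" "f \<in> J \<Longrightarrow> g * f \<in> J"
proof -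
  interpret ideal J mpoly_ring by fact
  show "0 \<in> J" using additive_subgroup.zero_closed[OF is_additive_subgroup] by simp
  show "f \<in> J \<Longrightarrow> g \<in> J \<Longrightarrow> f + g \<in> J" using additive_subgroup.a_closed[OF is_additive_subgroup, of f g] by simp
  show "f \<in> J \<Longrightarrow> g * f \<in> J" using I_l_closed[of f g] by simp
qed

abbreviation monomial :: "('v \<Rightarrow>\<^sub>0 nat) \<Rightarrow> ('v, 'k::field) mpoly" where
  "monomial c \<equiv> Poly_Mapping.single c 1"

abbreviation unit_exp :: "'v \<Rightarrow> ('v \<Rightarrow>\<^sub>0 nat)" where
  "unit_exp v \<equiv> Poly_Mapping.single v 1"

lemma mpoly_eq_sum_monomials:
  fixes f :: "'a \<Rightarrow>\<^sub>0 'b::comm_monoid_add"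
  shows "f = (\<Sum>c\<in>Poly_Mapping.keys f. Poly_Mapping.single c (Poly_Mapping.lookup f c))"
  by (rule poly_mapping_eqI)
    (simp add: lookup_sum lookup_single when_def sum.delta[where ?b = "\<lambda>_. _"] in_keys_iff)

lemma lookup_mult_eq_sum:
  fixes f g :: "('v, 'k::field) mpoly"
  shows "Poly_Mapping.lookup (f * g) k = (\<Sum>c\<in>Poly_Mapping.keys f. \<Sum>d\<in>Poly_Mapping.keys g.
    if c + d = k then Poly_Mapping.lookup f c * Poly_Mapping.lookup g d else 0)"
proof -
  have "f * g = (\<Sum>c\<in>Poly_Mapping.keys f. \<Sum>d\<in>Poly_Mapping.keys g.
      Poly_Mapping.single (c + d) (Poly_Mapping.lookup f c * Poly_Mapping.lookup g d))"
    by (subst mpoly_eq_sum_monomials[of f], subst mpoly_eq_sum_monomials[of g])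
      (simp only: sum_product mult_single)
  then show ?thesis
    by (simp add: lookup_sum lookup_single when_def)
qed

text \<open>A term whose exponent arises from one pair only cannot cancel, as a field has no zero
  divisors. Together with \<open>exists_unique_sum\<close> this takes the place of leading
  terms.\<close>

lemma lookup_mult_unique:
  fixes f g :: "('v, 'k::field) mpoly"
  assumes "c \<in> Poly_Mapping.keys f" "d \<in> Poly_Mapping.keys g"
    and uniq: "\<And>c' d'. c' \<in> Poly_Mapping.keys f \<Longrightarrow> d' \<in> Poly_Mapping.keys g \<Longrightarrow> c' + d' = c + d \<Longrightarrow> c' = c \<and> d' = d"
  shows "c + d \<in> Poly_Mapping.keys (f * g)"
proof -
  let ?X = "Poly_Mapping.lookup f c * Poly_Mapping.lookup g d"
  have "(\<Sum>d'\<in>Poly_Mapping.keys g. if c' + d' = c + d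
      then Poly_Mapping.lookup f c' * Poly_Mapping.lookup g d' else 0) = (if c' = c then ?X else 0)"
    if "c' \<in> Poly_Mapping.keys f" for c'
  proof -
    have "(\<Sum>d'\<in>Poly_Mapping.keys g. if c' + d' = c + d
        then Poly_Mapping.lookup f c' * Poly_Mapping.lookup g d' else 0) =
      (\<Sum>d'\<in>Poly_Mapping.keys g. if d' = d then (if c' = c then ?X else 0) else 0)"
      using uniq[OF that] by (intro sum.cong refl) auto
    then show ?thesis using assms(2) by simp
  qed
  then have "Poly_Mapping.lookup (f * g) (c + d) = ?X"
    unfolding lookup_mult_eq_sum using assms(1) by simp
  then show ?thesis using assms(1,2) by (simp add: in_keys_iff)
qed

lemma keys_monom_mult:
  fixes f :: "('v, 'k::field) mpoly"
  shows "Poly_Mapping.keys (monomial c * f) = (\<lambda>d. c + d) ` Poly_Mapping.keys f"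
proof
  show "Poly_Mapping.keys (monomial c * f) \<subseteq> (\<lambda>d. c + d) ` Poly_Mapping.keys f"
    using keys_mult[of "monomial c :: ('v, 'k) mpoly" f] by auto
  show "(\<lambda>d. c + d) ` Poly_Mapping.keys f \<subseteq> Poly_Mapping.keys (monomial c * f)"
    by (auto intro!: lookup_mult_unique)
qed

text \<open>The lexicographic order on \<open>nat \<Rightarrow>\<^sub>0 nat\<close> needs a linear order on the variables, which are
  therefore numbered.\<close>

lemma exists_unique_sum:
  fixes A B :: "('v::finite \<Rightarrow>\<^sub>0 nat) set"
  assumes "finite A" "A \<noteq> {}" "finite B" "B \<noteq> {}"
  obtains a b where "a \<in> A" "b \<in> B"
    "\<And>a' b'. a' \<in> A \<Longrightarrow> b' \<in> B \<Longrightarrow> a' + b' = a + b \<Longrightarrow> a' = a \<and> b' = b"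
proof -
  obtain e :: "'v \<Rightarrow> nat" where "inj e" using finite_imp_inj_to_nat_seg[of "UNIV :: 'v set"] by auto
  define \<phi> where "\<phi> c = (\<Sum>v\<in>UNIV. Poly_Mapping.single (e v) (Poly_Mapping.lookup c v))"
    for c :: "'v \<Rightarrow>\<^sub>0 nat"
  have add: "\<phi> (c + d) = \<phi> c + \<phi> d" for c d
    by (simp add: \<phi>_def lookup_add single_add sum.distrib)
  have "Poly_Mapping.lookup (\<phi> c) (e v) = Poly_Mapping.lookup c v" for c v
    using \<open>inj e\<close> by (simp add: \<phi>_def lookup_sum lookup_single when_def inj_eq)
  then have inj: "c = d" if "\<phi> c = \<phi> d" for c d
    using that by (metis poly_mapping_eqI)
  have max: "\<exists>a\<in>A. \<forall>x\<in>A. \<phi> x \<le> \<phi> a" if "finite A" "A \<noteq> {}" for A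
  proof -
    have "Max (\<phi> ` A) \<in> \<phi> ` A" using that by (intro Max_in) auto
    then obtain a where "a \<in> A" "Max (\<phi> ` A) = \<phi> a" by auto
    moreover have "\<phi> x \<le> Max (\<phi> ` A)" if "x \<in> A" for x
      using \<open>finite A\<close> that by (intro Max_ge) auto
    ultimately have "\<forall>x\<in>A. \<phi> x \<le> \<phi> a" by simp
    with \<open>a \<in> A\<close> show ?thesis by (rule bexI[rotated])
  qed
  \<comment> \<open>Since \<phi> is additive and injective, the sum of the two maxima is reached by
    no other pair.\<close>
  obtain a where a: "a \<in> A" "\<And>x. x \<in> A \<Longrightarrow> \<phi> x \<le> \<phi> a" using max[OF assms(1,2)] by blast
  obtain b where b: "b \<in> B" "\<And>x. x \<in> B \<Longrightarrow> \<phi> x \<le> \<phi> b" using max[OF assms(3,4)] by blast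
  show thesis
  proof (rule that[OF a(1) b(1)])
    fix a' b' assume ab: "a' \<in> A" "b' \<in> B" "a' + b' = a + b"
    then have "\<phi> a' + \<phi> b' = \<phi> a + \<phi> b" by (metis add)
    moreover have "\<phi> a' \<le> \<phi> a" "\<phi> b' \<le> \<phi> b" using a b ab by auto
    ultimately have "\<phi> a' = \<phi> a" "\<phi> b' = \<phi> b"
      by (metis add_le_cancel_left add_le_cancel_right add_mono order_antisym order_refl)+
    then show "a' = a \<and> b' = b" using inj by blast
  qed
qed

section \<open>Monomial ideals\<close>

text \<open>\<open>M\<close> lists the exponents of all monomials in the ideal, not only of
  generators, so it has to be \<open>up_closed\<close> for this to be an ideal.\<close>

definition mon_ideal :: "('v \<Rightarrow>\<^sub>0 nat) set \<Rightarrow> ('v, 'k::field) mpoly set" where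
  "mon_ideal M = {f. Poly_Mapping.keys f \<subseteq> M}"

definition up_closed :: "('v \<Rightarrow>\<^sub>0 nat) set \<Rightarrow> bool" where
  "up_closed M \<longleftrightarrow> (\<forall>c\<in>M. \<forall>d. d + c \<in> M)"

lemma monom_in_mon_ideal [simp]: "monomial c \<in> (mon_ideal M :: ('v, 'k::field) mpoly set) \<longleftrightarrow> c \<in> M"
  by (simp add: mon_ideal_def)

lemma ideal_mon_ideal:
  assumes "up_closed M"
  shows "ideal (mon_ideal M) (mpoly_ring :: ('v, 'k::field) mpoly ring)"
proof (rule ideal_mpoly_ringI)
  fix f g :: "('v, 'k) mpoly" assume "f \<in> mon_ideal M"
  then show "g * f \<in> mon_ideal M"
    using keys_mult[of g f] assms by (fastforce simp: mon_ideal_def up_closed_def)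
next
  fix f g :: "('v, 'k) mpoly" assume "f \<in> mon_ideal M" "g \<in> mon_ideal M"
  then show "f + g \<in> mon_ideal M"
    using keys_add[of f g] by (auto simp: mon_ideal_def)
qed (simp add: mon_ideal_def)

lemma mon_ideal_least:
  fixes J :: "('v, 'k::field) mpoly set"
  assumes J: "ideal J mpoly_ring" and M: "\<And>c. c \<in> M \<Longrightarrow> monomial c \<in> J"
  shows "mon_ideal M \<subseteq> J"
proof
  fix f :: "('v, 'k) mpoly" assume "f \<in> mon_ideal M"
  have "(\<Sum>c\<in>C. Poly_Mapping.single c (Poly_Mapping.lookup f c)) \<in> J" if "C \<subseteq> M" "finite C" for C
    using that(2,1)
  proof (induction C)
    case (insert c C)
    have "Poly_Mapping.single 0 (Poly_Mapping.lookup f c) * monomial c \<in> J"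
      using ideal_mpoly_ringD(3)[OF J] M insert by auto
    then have "Poly_Mapping.single c (Poly_Mapping.lookup f c) \<in> J"
      by (simp add: mult_single)
    then show ?case using insert ideal_mpoly_ringD(2)[OF J] by auto
  qed (simp add: ideal_mpoly_ringD(1)[OF J])
  from this[of "Poly_Mapping.keys f"] \<open>f \<in> _\<close> show "f \<in> J"
    by (simp add: mon_ideal_def flip: mpoly_eq_sum_monomials)
qed

lemma genideal_monomials:
  fixes S :: "('v, 'k::field) mpoly set"
  assumes "up_closed M" "S \<subseteq> mon_ideal M"
    and "\<And>c. c \<in> M \<Longrightarrow> \<exists>s d. s \<in> S \<and> monomial c = d * s"
  shows "Idl\<^bsub>mpoly_ring\<^esub> S = mon_ideal M"
proof
  interpret R: ring "mpoly_ring :: ('v, 'k) mpoly ring" by (rule ring_mpoly_ring)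
  show "Idl\<^bsub>mpoly_ring\<^esub> S \<subseteq> mon_ideal M"
    using R.genideal_minimal[OF ideal_mon_ideal] assms by blast
  have ideal: "ideal (Idl\<^bsub>mpoly_ring\<^esub> S) (mpoly_ring :: ('v, 'k) mpoly ring)"
    by (rule R.genideal_ideal) simp
  show "mon_ideal M \<subseteq> Idl\<^bsub>mpoly_ring\<^esub> S"
  proof (rule mon_ideal_least[OF ideal])
    fix c assume "c \<in> M"
    then obtain s d where "s \<in> S" "(monomial c :: ('v, 'k) mpoly) = d * s" using assms(3) by blast
    then show "(monomial c :: ('v, 'k) mpoly) \<in> Idl\<^bsub>mpoly_ring\<^esub> S"
      using ideal_mpoly_ringD(3)[OF ideal] R.genideal_self[of S] by auto
  qed
qed

lemma ideal_prod_mon_ideal: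
  fixes M N :: "('v \<Rightarrow>\<^sub>0 nat) set"
  assumes "up_closed M" "up_closed N"
  shows "ideal_prod mpoly_ring (mon_ideal M) (mon_ideal N) =
    (mon_ideal {c + d | c d. c \<in> M \<and> d \<in> N} :: ('v, 'k::field) mpoly set)" (is "?P = mon_ideal ?S")
proof
  interpret R: ring "mpoly_ring :: ('v, 'k) mpoly ring" by (rule ring_mpoly_ring)
  show "?P \<subseteq> mon_ideal ?S"
  proof
    fix f assume "f \<in> ?P"
    then show "f \<in> mon_ideal ?S"
    proof induction
      case (prod f g)
      then show ?case using keys_mult[of f g] by (fastforce simp: mon_ideal_def)
    next
      case (sum f g)
      then show ?case using keys_add[of f g] by (auto simp: mon_ideal_def)
    qed
  qed
  show "mon_ideal ?S \<subseteq> ?P"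
  proof (rule mon_ideal_least)
    show "ideal ?P mpoly_ring"
      using assms by (intro R.ideal_prod_is_ideal ideal_mon_ideal)
    fix c assume "c \<in> ?S"
    then obtain a b where "c = a + b" "a \<in> M" "b \<in> N" by blast
    then show "monomial c \<in> ?P"
      using ideal_prod.prod[of "monomial a" "mon_ideal M" "monomial b" "mon_ideal N"
          "mpoly_ring :: ('v, 'k) mpoly ring"]
      by (simp add: mult_single)
  qed
qed

text \<open>The exponents of the monomials that lie in the prime of \<open>U\<close>.\<close>

definition meets :: "'v set \<Rightarrow> ('v \<Rightarrow>\<^sub>0 nat) set" where
  "meets U = {c. Poly_Mapping.keys c \<inter> U \<noteq> {}}"

lemma keys_add_nat: "Poly_Mapping.keys (c + d) = Poly_Mapping.keys c \<union> Poly_Mapping.keys (d :: _ \<Rightarrow>\<^sub>0 nat)"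
  by (auto simp: in_keys_iff lookup_add)

lemma exponent_split:
  fixes c :: "'v \<Rightarrow>\<^sub>0 nat"
  assumes "v \<in> Poly_Mapping.keys c"
  obtains d where "c = d + unit_exp v"
proof
  show "c = (c - unit_exp v) + unit_exp v"
    using assms by (intro poly_mapping_eqI)
      (auto simp: lookup_add lookup_minus lookup_single when_def in_keys_iff)
qed

lemma var_prime_eq: "var_prime U = mon_ideal (meets U)"
  unfolding var_prime_def
proof (rule genideal_monomials)
  show "up_closed (meets U)" by (auto simp: up_closed_def meets_def keys_add_nat)
  show "var ` U \<subseteq> mon_ideal (meets U)" by (auto simp: var_def meets_def)
  fix c assume "c \<in> meets U"
  then obtain u where u: "u \<in> U" "u \<in> Poly_Mapping.keys c" by (auto simp: meets_def)
  obtain d where "c = d + unit_exp u" using exponent_split[OF u(2)] .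
  then show "\<exists>s d. s \<in> var ` U \<and> monomial c = d * s"
    using u by (intro exI[of _ "var u"] exI[of _ "monomial d"]) (simp add: var_def mult_single)
qed

text \<open>If neither factor is in the ideal, both have terms outside it, and two of these have a
  product whose exponent arises in one way only. Terms inside the ideal cannot produce this
  exponent, as it avoids \<open>U\<close>, so it survives in \<open>f * g\<close>.\<close>

lemma primeideal_var_prime:
  fixes U :: "'v::finite set"
  shows "primeideal (var_prime U) (mpoly_ring :: ('v, 'k::field) mpoly ring)"
proof (rule primeidealI)
  show "ideal (var_prime U) (mpoly_ring :: ('v, 'k) mpoly ring)"
    unfolding var_prime_eq by (rule ideal_mon_ideal) (auto simp: up_closed_def meets_def keys_add_nat)
  have "(1 :: ('v, 'k) mpoly) \<notin> var_prime U"
    by (simp add: var_prime_eq mon_ideal_def meets_def)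
  then show "carrier mpoly_ring \<noteq> (var_prime U :: ('v, 'k) mpoly set)" by auto
  fix f g :: "('v, 'k) mpoly"
  assume "f \<otimes>\<^bsub>mpoly_ring\<^esub> g \<in> var_prime U"
  then have fg: "Poly_Mapping.keys (f * g) \<subseteq> meets U" by (simp add: var_prime_eq mon_ideal_def)
  show "f \<in> var_prime U \<or> g \<in> var_prime U"
  proof (rule ccontr)
    assume "\<not> (f \<in> var_prime U \<or> g \<in> var_prime U)"
    then have "Poly_Mapping.keys f - meets U \<noteq> {}" "Poly_Mapping.keys g - meets U \<noteq> {}"
      by (auto simp: var_prime_eq mon_ideal_def)
    then obtain a b where ab: "a \<in> Poly_Mapping.keys f - meets U" "b \<in> Poly_Mapping.keys g - meets U"
      and uniq: "\<And>a' b'. a' \<in> Poly_Mapping.keys f - meets U \<Longrightarrow> b' \<in> Poly_Mapping.keys g - meets U \<Longrightarrow>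
        a' + b' = a + b \<Longrightarrow> a' = a \<and> b' = b"
      using exists_unique_sum[of "Poly_Mapping.keys f - meets U" "Poly_Mapping.keys g - meets U"] by auto
    have add: "c + d \<in> meets U \<longleftrightarrow> c \<in> meets U \<or> d \<in> meets U" for c d :: "'v \<Rightarrow>\<^sub>0 nat"
      by (auto simp: meets_def keys_add_nat)
    have "a + b \<in> Poly_Mapping.keys (f * g)"
      using ab uniq add by (intro lookup_mult_unique) (metis DiffD1 DiffD2 DiffI)+
    then show False using fg ab add by auto
  qed
qed (rule cring_mpoly_ring)

lemma monom_in_primeideal:
  fixes P :: "('v::finite, 'k::field) mpoly set"
  assumes "primeideal P mpoly_ring" "monomial c \<in> P"
  obtains v where "v \<in> Poly_Mapping.keys c" "var v \<in> P"
proof -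
  interpret primeideal P "mpoly_ring :: ('v, 'k) mpoly ring" by fact
  have ideal: "ideal P mpoly_ring" by (rule is_ideal)
  have "\<exists>v\<in>Poly_Mapping.keys c. var v \<in> P"
    using assms(2)
  proof (induction "\<Sum>v\<in>UNIV. Poly_Mapping.lookup c v" arbitrary: c rule: less_induct)
    case less
    show ?case
    proof (cases "c = 0")
      case True
      then have "1 \<in> P" using less(2) by simp
      then have "f \<in> P" for f using ideal_mpoly_ringD(3)[OF ideal, of 1 f] by simp
      then show ?thesis using I_notcarr by auto
    next
      case False
      then obtain v where v: "v \<in> Poly_Mapping.keys c" by (metis all_not_in_conv keys_eq_empty)
      then obtain d where d: "c = d + unit_exp v" by (rule exponent_split)
      then have "monomial d * var v \<in> P" using less(2) by (simp add: var_def mult_single)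
      then consider "monomial d \<in> P" | "var v \<in> P" using I_prime[of "monomial d" "var v"] by auto
      then show ?thesis
      proof cases
        case 1
        have "(\<Sum>v\<in>UNIV. Poly_Mapping.lookup d v) < (\<Sum>v\<in>UNIV. Poly_Mapping.lookup c v)"
          by (rule sum_strict_mono_ex1) (auto simp: d lookup_add intro: exI[of _ v])
        from less(1)[OF this 1] show ?thesis by (auto simp: d keys_add_nat)
      qed (use v in auto)
    qed
  qed
  then show thesis using that by blast
qed

section \<open>Associated primes of monomial ideals\<close>

text \<open>In other words, \<open>(mon_ideal M : monomial a)\<close> is the prime generated by the variables in \<open>U\<close>.\<close>

definition colon_witness :: "('v \<Rightarrow>\<^sub>0 nat) set \<Rightarrow> 'v set \<Rightarrow> ('v \<Rightarrow>\<^sub>0 nat) \<Rightarrow> bool" where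
  "colon_witness M U a \<longleftrightarrow> (\<forall>b. b \<notin> meets U \<longrightarrow> b + a \<notin> M) \<and> (\<forall>u\<in>U. unit_exp u + a \<in> M)"

text \<open>For a witness \<open>a\<close>, the monomial with exponents \<open>a\<close> has the
  prime of \<open>U\<close> as its annihilator. Conversely, if the annihilator of an arbitrary
  polynomial \<open>f\<close> is prime, it is generated by the variables in it, and a single term of
  \<open>f\<close> is a witness.\<close>

lemma ass_primes_mon_ideal:
  fixes M :: "('v::finite \<Rightarrow>\<^sub>0 nat) set"
  assumes M: "up_closed M"
  shows "ass_primes mpoly_ring (mon_ideal M :: ('v, 'k::field) mpoly set) =
    var_prime ` {U. \<exists>a. colon_witness M U a}"
proof (intro equalityI subsetI)
  fix P :: "('v, 'k) mpoly set"
  assume "P \<in> var_prime ` {U. \<exists>a. colon_witness M U a}"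
  then obtain U a where P: "P = var_prime U" and a: "colon_witness M U a" by auto
  have "r \<in> var_prime U \<longleftrightarrow> r * monomial a \<in> mon_ideal M" for r :: "('v, 'k) mpoly"
  proof -
    have "c \<in> meets U \<longleftrightarrow> a + c \<in> M" for c
    proof
      assume "c \<in> meets U"
      then obtain u where u: "u \<in> U" "u \<in> Poly_Mapping.keys c" by (auto simp: meets_def)
      obtain d where "c = d + unit_exp u" using exponent_split[OF u(2)] .
      moreover have "d + (unit_exp u + a) \<in> M"
        using a M u by (auto simp: colon_witness_def up_closed_def)
      ultimately show "a + c \<in> M" by (simp add: ac_simps)
    next
      assume "a + c \<in> M"
      then show "c \<in> meets U" using a by (auto simp: colon_witness_def add.commute)
    qed
    then show ?thesis
      by (auto simp: var_prime_eq mon_ideal_def keys_monom_mult mult.commute[of r])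
  qed
  then show "P \<in> ass_primes mpoly_ring (mon_ideal M)"
    unfolding ass_primes_def P using primeideal_var_prime[of U] by auto
next
  fix P :: "('v, 'k) mpoly set"
  assume "P \<in> ass_primes mpoly_ring (mon_ideal M)"
  then obtain f where "primeideal P mpoly_ring" and P: "P = {r. r * f \<in> mon_ideal M}"
    by (auto simp: ass_primes_def)
  then interpret primeideal P "mpoly_ring :: ('v, 'k) mpoly ring" by simp
  have ideal: "ideal P mpoly_ring" by (rule is_ideal)
  define U where "U = {v. var v \<in> P}"
  have var_f: "unit_exp u + a \<in> M" if "u \<in> U" "a \<in> Poly_Mapping.keys f" for u a
    using that by (auto simp: U_def P var_def mon_ideal_def keys_monom_mult)
  \<comment> \<open>The terms of \<open>f\<close> that survive multiplication with every monomial outside \<open>P\<close>: any of them is a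
    witness. They suffice to detect \<open>P\<close>, because products with the other terms lie in the ideal.\<close>
  define A where "A = {a \<in> Poly_Mapping.keys f. \<forall>b. b \<notin> meets U \<longrightarrow> b + a \<notin> M}"
  \<comment> \<open>Otherwise each term \<open>a\<close> of \<open>f\<close> is carried into
    \<open>M\<close> by some \<open>\<beta> a\<close> free of \<open>U\<close>. The product of these
    monomials is in \<open>P\<close>, so one of them would involve a variable in \<open>P\<close>,
    that is, from \<open>U\<close>.\<close>
  have "A \<noteq> {}"
  proof
    assume "A = {}"
    then obtain \<beta> where \<beta>: "\<And>a. a \<in> Poly_Mapping.keys f \<Longrightarrow> \<beta> a \<notin> meets U \<and> \<beta> a + a \<in> M"
      unfolding A_def by (auto dest!: Collect_empty_eq[THEN iffD1]) metis
    define b where "b = (\<Sum>a\<in>Poly_Mapping.keys f. \<beta> a)"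
    have "b + a \<in> M" if "a \<in> Poly_Mapping.keys f" for a
    proof -
      have "b + a = (\<Sum>x\<in>Poly_Mapping.keys f - {a}. \<beta> x) + (\<beta> a + a)"
        using that by (simp add: b_def sum.remove[of _ a] ac_simps)
      then show ?thesis using \<beta>[OF that] M by (simp add: up_closed_def)
    qed
    then have "monomial b \<in> P" by (auto simp: P mon_ideal_def keys_monom_mult)
    then obtain v where "v \<in> Poly_Mapping.keys b" "var v \<in> P"
      using monom_in_primeideal primeideal_axioms by blast
    then have "b \<in> meets U" by (auto simp: meets_def U_def)
    moreover have "b \<notin> meets U" if "\<And>a. a \<in> C \<Longrightarrow> \<beta> a \<notin> meets U" "b = (\<Sum>a\<in>C. \<beta> a)" for b C
    proof -
      have "(\<Sum>a\<in>C. \<beta> a) \<notin> meets U"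
        using that(1) by (induction C rule: infinite_finite_induct) (auto simp: meets_def keys_add_nat)
      then show ?thesis using that by simp
    qed
    ultimately show False using \<beta> b_def by blast
  qed
  have "P \<subseteq> var_prime U"
  proof
    fix r assume "r \<in> P"
    then have rf: "Poly_Mapping.keys (r * f) \<subseteq> M" by (simp add: P mon_ideal_def)
    show "r \<in> var_prime U"
    proof (rule ccontr)
      assume "r \<notin> var_prime U"
      then have "Poly_Mapping.keys r - meets U \<noteq> {}" by (auto simp: var_prime_eq mon_ideal_def)
      then obtain c a where ca: "c \<in> Poly_Mapping.keys r - meets U" "a \<in> A"
        and uniq: "\<And>c' a'. c' \<in> Poly_Mapping.keys r - meets U \<Longrightarrow> a' \<in> A \<Longrightarrow> c' + a' = c + a \<Longrightarrow> c' = c \<and> a' = a"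
        using exists_unique_sum[of "Poly_Mapping.keys r - meets U" A] \<open>A \<noteq> {}\<close> by (auto simp: A_def)
      have caM: "b + (c + a) \<notin> M" if "b \<notin> meets U" for b
      proof -
        have "b + c \<notin> meets U" using that ca by (auto simp: meets_def keys_add_nat)
        then show ?thesis using ca by (auto simp: A_def simp flip: add.assoc)
      qed
      \<comment> \<open>A pair with the same sum but outside the range of \<open>uniq\<close> would
        put \<open>c + a\<close>, or its product with a monomial free of \<open>U\<close>, into
        \<open>M\<close>.\<close>
      have "c + a \<in> Poly_Mapping.keys (r * f)"
      proof (rule lookup_mult_unique)
        fix c' a' assume *: "c' \<in> Poly_Mapping.keys r" "a' \<in> Poly_Mapping.keys f" "c' + a' = c + a"
        have "c' \<notin> meets U"
        proof
          assume "c' \<in> meets U"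
          then obtain u where u: "u \<in> U" "u \<in> Poly_Mapping.keys c'" by (auto simp: meets_def)
          obtain d where "c' = d + unit_exp u" using exponent_split[OF u(2)] .
          then have "c + a = d + (unit_exp u + a')" using *(3) by (simp add: add.assoc)
          then have "c + a \<in> M" using var_f[OF u(1) *(2)] M by (auto simp: up_closed_def)
          then show False using caM[of 0] by (simp add: meets_def)
        qed
        moreover have "a' \<in> A"
        proof (rule ccontr)
          assume "a' \<notin> A"
          then obtain b where b: "b \<notin> meets U" "b + a' \<in> M" using *(2) by (auto simp: A_def)
          have "b + (c + a) = c' + (b + a')" using *(3) by (metis add.left_commute)
          then show False using caM[OF b(1)] b(2) M by (auto simp: up_closed_def)
        qed
        ultimately show "c' = c \<and> a' = a" using uniq * by blast
      qed (use ca in \<open>auto simp: A_def\<close>)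
      then show False using rf caM[of 0] by (auto simp: meets_def)
    qed
  qed
  moreover have "var_prime U \<subseteq> P"
    unfolding var_prime_def by (rule genideal_minimal[OF ideal]) (auto simp: U_def)
  moreover obtain a where "a \<in> A" using \<open>A \<noteq> {}\<close> by auto
  then have "colon_witness M U a" using var_f by (auto simp: colon_witness_def A_def)
  ultimately show "P \<in> var_prime ` {U. \<exists>a. colon_witness M U a}" by blast
qed

lemma var_prime_eq_iff [simp]:
  "(var_prime U :: ('v, 'k::field) mpoly set) = var_prime V \<longleftrightarrow> U = V"
proof
  assume eq: "(var_prime U :: ('v, 'k) mpoly set) = var_prime V"
  have "u \<in> U \<longleftrightarrow> var u \<in> (var_prime U :: ('v, 'k) mpoly set)" for u :: 'v and U
    by (simp add: var_prime_eq var_def meets_def)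
  with eq show "U = V" by blast
qed simp

section \<open>Components and closed walks\<close>

lemma awalk_imp_relpow:
  assumes "tail H = fst" "head H = snd" "pre_digraph.awalk H u p v"
  shows "(u, v) \<in> arcs H ^^ length p"
proof -
  have "set p \<subseteq> arcs H" "pre_digraph.cas H u p v"
    using assms(3) by (auto simp: pre_digraph.awalk_def)
  then show ?thesis
  proof (induction p arbitrary: u)
    case (Cons e p)
    then have "(u, snd e) \<in> arcs H" "(snd e, v) \<in> arcs H ^^ length p"
      using assms(1,2) by (auto simp: pre_digraph.cas.simps)
    then show ?case using relpow_Suc_I2 by (metis length_Cons)
  qed (simp add: pre_digraph.cas.simps)
qed

lemma relpow_imp_awalk:
  assumes "wf_digraph H" "tail H = fst" "head H = snd" "(u, v) \<in> arcs H ^^ n" "u \<in> verts H"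
  shows "\<exists>p. pre_digraph.awalk H u p v \<and> length p = n"
  using assms(4,5)
proof (induction n arbitrary: u)
  case 0
  then show ?case by (auto simp: pre_digraph.awalk_def pre_digraph.cas.simps)
next
  case (Suc n)
  interpret wf_digraph H by fact
  obtain x where x: "(u, x) \<in> arcs H" "(x, v) \<in> arcs H ^^ n"
    using Suc(2) by (meson relpow_Suc_D2)
  then have "x \<in> verts H" using head_in_verts[OF x(1)] assms(3) by simp
  then obtain p where "awalk x p v" "length p = n" using Suc.IH x by blast
  then show ?case
    using x assms(2,3) by (intro exI[of _ "(u, x) # p"]) (simp add: awalk_Cons_iff)
qed

text \<open>A closed walk that repeats a vertex, apart from its end points, splits into two shorter
  closed walks, one of them of odd length. Without a repetition it is a cycle.\<close>

lemma (in wf_digraph) odd_closed_awalk_imp_odd_cycle: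
  assumes "awalk u p u" "odd (length p)"
  shows "has_odd_cycle G"
  using assms
proof (induction "length p" arbitrary: u p rule: less_induct)
  case less
  then have "p \<noteq> []" by auto
  then obtain e es where p: "p = e # es" by (cases p) auto
  show ?case
  proof (cases "distinct (tl (awalk_verts u p))")
    case True
    then show ?thesis using less(2,3) \<open>p \<noteq> []\<close> by (auto simp: has_odd_cycle_def cycle_def)
  next
    case False
    then have es: "awalk (head G e) es u" "\<not> distinct (awalk_verts (head G e) es)"
      using less(2) by (auto simp: p awalk_Cons_iff)
    then obtain q r s w where es_eq: "es = q @ r @ s" and "0 < length r"
      and w: "awalk (head G e) q w" "awalk w r w" "awalk w s u"
      using awalk_not_distinct_decomp[OF es] by blast
    have "awalk u (e # q @ s) u"
      using less(2) w by (auto simp: p awalk_Cons_iff)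
    moreover have "odd (length r) \<or> odd (length (e # q @ s))"
      using less(3) by (auto simp: p es_eq)
    ultimately show ?thesis
      using less(1)[of r w] less(1)[of "e # q @ s" u] w \<open>0 < length r\<close> by (auto simp: p es_eq)
  qed
qed

text \<open>In a symmetric digraph, connectedness amounts to reachability along arcs. So every
  connected subgraph through \<open>w\<close> lies in the subgraph induced on what \<open>w\<close>
  reaches, and the latter is itself connected.\<close>

lemma (in sym_digraph) components_eq:
  "components G = (\<lambda>w. G \<restriction> {v. w \<rightarrow>\<^sup>* v}) ` verts G"
proof -
  define S where "S w = {v. w \<rightarrow>\<^sup>* v}" for w
  have sym: "v \<rightarrow>\<^sup>* w" if "w \<rightarrow>\<^sup>* v" for v w
    using that symmetric_reachable[OF sym_arcs] by blast
  have S_eq: "S x = S w" if "x \<in> S w" for x w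
    using that sym unfolding S_def by (auto intro: reachable_trans)
  have sub: "subgraph (G \<restriction> S w) G" for w
    by (rule subgraph_induce_subgraphI) (auto simp: S_def reachable_in_verts)
  have conn: "connected (G \<restriction> S w)" if "w \<in> verts G" for w
  proof -
    interpret K: wf_digraph "G \<restriction> S w" by (rule wellformed_induce_subgraph)
    have "w \<in> S w" using that by (simp add: S_def)
    moreover have "x \<rightarrow>\<^sup>*\<^bsub>mk_symmetric (G \<restriction> S w)\<^esub> y" if "x \<in> S w" "y \<in> S w" for x y
    proof (rule K.reachable_mk_symmetricI)
      have "x \<rightarrow>\<^sup>* y" using that S_eq[OF that(1)] by (auto simp: S_def)
      from induce_reachable_preserves_paths[OF this] show "x \<rightarrow>\<^sup>*\<^bsub>G \<restriction> S w\<^esub> y"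
        using S_eq[OF that(1)] by (simp add: S_def)
    qed
    ultimately show ?thesis
      unfolding connected_def strongly_connected_def by auto
  qed
  have max: "subgraph C (G \<restriction> S w)" if C: "subgraph C G" "connected C" "w \<in> verts C" for C w
  proof -
    have "w \<rightarrow>\<^sup>* v" if "v \<in> verts C" for v
    proof -
      have "w \<rightarrow>\<^sup>*\<^bsub>mk_symmetric C\<^esub> v"
        using C that by (simp add: connected_def strongly_connected_def)
      then have "w \<rightarrow>\<^sup>*\<^bsub>mk_symmetric G\<^esub> v"
        using subgraph_mk_symmetric[OF C(1)] by (rule pre_digraph.reachable_mono)
      then show ?thesis using reachable_mk_symmetric_eq[OF sym_arcs] by simp
    qed
    then have "verts C \<subseteq> S w" by (auto simp: S_def)
    moreover have "subgraph C (G \<restriction> verts C)" by (rule subgraph_induce_subgraphI2[OF C(1)])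
    ultimately show ?thesis
      by (auto simp: subgraph_def compatible_def intro: wellformed_induce_subgraph)
  qed
  have antisym: "A = B" if "subgraph A B" "subgraph B A" for A B :: "('a, 'b) pre_digraph"
    using that by (intro pre_digraph.equality) (auto simp: subgraph_def compatible_def)
  show ?thesis
    unfolding components_def S_def[symmetric]
  proof (intro equalityI subsetI)
    fix C assume "C \<in> {C. max_subgraph connected C}"
    then have C: "subgraph C G" "connected C"
      and C_max: "\<And>H'. H' \<noteq> C \<Longrightarrow> subgraph C H' \<Longrightarrow> subgraph H' G \<Longrightarrow> \<not> connected H'"
      by (auto simp: max_subgraph_def)
    obtain w where w: "w \<in> verts C"
      using C(2) by (auto simp: connected_def strongly_connected_def)
    then have "w \<in> verts G" using C(1) by auto
    then show "C \<in> (\<lambda>w. G \<restriction> S w) ` verts G"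
      using C_max[OF _ max[OF C w] sub] conn by blast
  next
    fix C assume "C \<in> (\<lambda>w. G \<restriction> S w) ` verts G"
    then obtain w where w: "w \<in> verts G" "C = G \<restriction> S w" by blast
    have "H' = C" if "subgraph C H'" "subgraph H' G" "connected H'" for H'
    proof (rule antisym)
      have "w \<in> verts H'" using subgraph_imp_subverts[OF that(1)] w by (auto simp: S_def)
      then show "subgraph H' C" using max that w by simp
    qed fact
    then show "C \<in> {C. max_subgraph connected C}"
      using w sub conn by (auto simp: max_subgraph_def)
  qed
qed

text \<open>From \<open>w\<close> one can go to an odd cycle of its component, around it and back
  the same way, which keeps the parity odd. Conversely, an odd closed walk at \<open>w\<close> stays
  in the component and contains an odd cycle.\<close>

lemma components_have_odd_cycle_iff:
  assumes "pair_graph G" "W \<subseteq> pverts G"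
  shows "(\<forall>C \<in> components (with_proj G \<restriction> W). has_odd_cycle C) \<longleftrightarrow>
    (\<forall>w\<in>W. \<exists>n. odd n \<and> (w, w) \<in> Restr (parcs G) W ^^ n)"
proof -
  interpret pair_graph G by fact
  define H where "H = with_proj G \<restriction> W"
  interpret H: sym_digraph H
    unfolding H_def using assms(2) by (intro induced_graph_imp_graph induced_induce) simp
  have [simp]: "tail H = fst" "head H = snd" "verts H = W" and arcs_H: "arcs H = Restr (parcs G) W"
    by (auto simp: H_def)
  have "sym (arcs H)" using arcs_symmetric by (auto simp: arcs_H sym_def)
  have "has_odd_cycle (H \<restriction> {v. w \<rightarrow>\<^sup>*\<^bsub>H\<^esub> v}) \<longleftrightarrow> (\<exists>n. odd n \<and> (w, w) \<in> arcs H ^^ n)" if "w \<in> W" for w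
  proof
    let ?K = "H \<restriction> {v. w \<rightarrow>\<^sup>*\<^bsub>H\<^esub> v}"
    interpret K: wf_digraph ?K by (rule H.wellformed_induce_subgraph)
    {
      assume "has_odd_cycle ?K"
      then obtain p u where p: "K.awalk u p u" "odd (length p)"
        by (auto simp: has_odd_cycle_def K.cycle_def)
      then have "w \<rightarrow>\<^sup>*\<^bsub>H\<^esub> u" using K.awalk_hd_in_verts by auto
      then obtain m where m: "(w, u) \<in> arcs H ^^ m"
        using awalk_imp_relpow[of H w _ u] by (auto simp: H.reachable_awalk)
      have "subgraph ?K H"
        by (rule H.subgraph_induce_subgraphI) (auto dest: H.reachable_in_verts)
      from H.subgraph_awalk_imp_awalk[OF p(1) this]
      have "(u, u) \<in> arcs H ^^ length p" by (intro awalk_imp_relpow) simp_all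
      then have "(w, w) \<in> arcs H ^^ (m + (length p + m))"
        using m relpow_sym[OF \<open>sym (arcs H)\<close> m] unfolding relpow_add by blast
      then show "\<exists>n. odd n \<and> (w, w) \<in> arcs H ^^ n"
        using p(2) by (intro exI[of _ "m + (length p + m)"]) simp
    }
    assume "\<exists>n. odd n \<and> (w, w) \<in> arcs H ^^ n"
    then obtain n where n: "odd n" "(w, w) \<in> arcs H ^^ n" by blast
    then obtain p where p: "H.awalk w p w" "length p = n"
      using relpow_imp_awalk[OF H.wf_digraph_axioms _ _ n(2)] \<open>w \<in> W\<close> by auto
    have "K.awalk w p w"
      using p(1) by (rule H.awalk_induce) (use H.awalk_verts_reachable_from[OF p(1)] in auto)
    then show "has_odd_cycle ?K"
      using K.odd_closed_awalk_imp_odd_cycle p(2) n(1) by simp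
  qed
  then show ?thesis
    using H.components_eq by (auto simp flip: H_def arcs_H)
qed

section \<open>Powers of edge ideals\<close>

lemma up_closed_fits: "up_closed {c. fits E k (Poly_Mapping.lookup c)}"
  by (auto simp: up_closed_def lookup_add elim: fits_mono)

lemma fits_Suc_split:
  fixes c :: "'v \<Rightarrow>\<^sub>0 nat"
  assumes "fits E (Suc k) (Poly_Mapping.lookup c)"
  obtains x y d where "(x, y) \<in> E" "c = d + (unit_exp x + unit_exp y)" "fits E k (Poly_Mapping.lookup d)"
proof -
  obtain e where e: "e \<in> E" "\<forall>v. of_bool (fst e = v) + of_bool (snd e = v) \<le> Poly_Mapping.lookup c v"
    "fits E k (\<lambda>v. Poly_Mapping.lookup c v - (of_bool (fst e = v) + of_bool (snd e = v)))"
    by (rule fits_Suc_D[OF assms])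
  define u where "u = unit_exp (fst e) + unit_exp (snd e)"
  have u: "Poly_Mapping.lookup u v = of_bool (fst e = v) + of_bool (snd e = v)" for v
    by (simp add: u_def lookup_add lookup_single when_def)
  show thesis
  proof (rule that[of "fst e" "snd e" "c - u"])
    show "(fst e, snd e) \<in> E" using e(1) by simp
    have "c = c - u + u"
      using e(2) by (intro poly_mapping_eqI) (simp add: lookup_add lookup_minus u)
    then show "c = c - u + (unit_exp (fst e) + unit_exp (snd e))" by (simp add: u_def)
    show "fits E k (Poly_Mapping.lookup (c - u))"
      using e(3) by (rule fits_mono) (simp add: lookup_minus u)
  qed
qed

lemma fits_edge: "(x, y) \<in> E \<Longrightarrow> fits E 1 (Poly_Mapping.lookup (unit_exp x + unit_exp y))"
  using fitsI[of "{#(x, y)#}" E] by (simp add: lookup_add lookup_single when_def)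

lemma edge_ideal_eq:
  "edge_ideal G = mon_ideal {c. fits (parcs G) 1 (Poly_Mapping.lookup c)}"
  unfolding edge_ideal_def
proof (rule genideal_monomials[OF up_closed_fits])
  show "{var u * var v |u v. (u, v) \<in> parcs G} \<subseteq> mon_ideal {c. fits (parcs G) 1 (Poly_Mapping.lookup c)}"
    using fits_edge[of _ _ "parcs G"] by (auto simp: var_def mult_single)
  fix c :: "'a \<Rightarrow>\<^sub>0 nat" assume "c \<in> {c. fits (parcs G) 1 (Poly_Mapping.lookup c)}"
  then have "fits (parcs G) (Suc 0) (Poly_Mapping.lookup c)" by simp
  then obtain x y d where "(x, y) \<in> parcs G" "c = d + (unit_exp x + unit_exp y)"
    by (rule fits_Suc_split)
  then show "\<exists>s d. s \<in> {var u * var v |u v. (u, v) \<in> parcs G} \<and> monomial c = d * s"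
    by (intro exI[of _ "var x * var y"] exI[of _ "monomial d"]) (auto simp: var_def mult_single)
qed

lemma ideal_power_edge_ideal:
  "ideal_power mpoly_ring (edge_ideal G :: ('v, 'k::field) mpoly set) k =
    mon_ideal {c. fits (parcs G) k (Poly_Mapping.lookup c)}"
proof (induction k)
  case 0
  \<comment> \<open>The zeroth power is the whole ring, and every exponent vector admits zero
    edges.\<close>
  have "\<one>\<^bsub>ideals_set R\<^esub> = carrier R" for R :: "('v, 'k) mpoly ring" by (simp add: ideals_set_def)
  then show ?case by (simp add: mon_ideal_def)
next
  case (Suc k)
  let ?M = "\<lambda>k. {c. fits (parcs G) k (Poly_Mapping.lookup c)}"
  have "ideal_power mpoly_ring (edge_ideal G :: ('v, 'k) mpoly set) (Suc k) =
    ideal_prod mpoly_ring (mon_ideal (?M k)) (mon_ideal (?M 1))"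
    using Suc by (simp add: ideals_set_def edge_ideal_eq flip: One_nat_def)
  also have "\<dots> = mon_ideal {c + d | c d. c \<in> ?M k \<and> d \<in> ?M 1}"
    by (rule ideal_prod_mon_ideal) (rule up_closed_fits)+
  also have "{c + d | c d. c \<in> ?M k \<and> d \<in> ?M 1} = ?M (Suc k)"
  proof (intro equalityI subsetI)
    fix c assume "c \<in> {c + d | c d. c \<in> ?M k \<and> d \<in> ?M 1}"
    then obtain a b where c: "c = a + b" "fits (parcs G) k (Poly_Mapping.lookup a)"
      "fits (parcs G) 1 (Poly_Mapping.lookup b)" by blast
    from fits_add[OF c(2,3)] show "c \<in> ?M (Suc k)" by (simp add: c(1) plus_poly_mapping.rep_eq)
  next
    fix c assume "c \<in> ?M (Suc k)"
    then have "fits (parcs G) (Suc k) (Poly_Mapping.lookup c)" by simp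
    then obtain x y d where "(x, y) \<in> parcs G" "c = d + (unit_exp x + unit_exp y)"
      "fits (parcs G) k (Poly_Mapping.lookup d)"
      by (rule fits_Suc_split)
    then show "c \<in> {c + d | c d. c \<in> ?M k \<and> d \<in> ?M 1}"
      using fits_edge[of x y "parcs G"] by blast
  qed
  finally show ?case .
qed

text \<open>On a finite type every function has finite support, so exponent vectors may be exchanged
  for plain functions.\<close>

lemma all_lookup_iff:
  fixes P :: "('v::finite \<Rightarrow> nat) \<Rightarrow> bool"
  shows "(\<forall>c. P (Poly_Mapping.lookup c)) \<longleftrightarrow> (\<forall>f. P f)"
proof safe
  fix f assume "\<forall>c. P (Poly_Mapping.lookup c)"
  then have "P (Poly_Mapping.lookup (Abs_poly_mapping f))" ..
  then show "P f" by simp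
qed simp

lemma ex_lookup_iff:
  fixes P :: "('v::finite \<Rightarrow> nat) \<Rightarrow> bool"
  shows "(\<exists>c. P (Poly_Mapping.lookup c)) \<longleftrightarrow> (\<exists>f. P f)"
  using all_lookup_iff[of "\<lambda>f. \<not> P f"] by blast

lemma colon_witness_fits_iff:
  fixes U :: "'v::finite set"
  shows "(\<exists>a. colon_witness {c. fits E k (Poly_Mapping.lookup c)} U a) \<longleftrightarrow>
    (\<exists>a. (\<forall>b. (\<forall>u\<in>U. b u = 0) \<longrightarrow> \<not> fits E k (\<lambda>v. a v + b v)) \<and> (\<forall>u\<in>U. fits E k (a(u := Suc (a u)))))"
    (is "_ \<longleftrightarrow> (\<exists>a. ?W a)")
proof -
  have "colon_witness {c. fits E k (Poly_Mapping.lookup c)} U a \<longleftrightarrow> ?W (Poly_Mapping.lookup a)" for a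
  proof -
    have off: "b \<notin> meets U \<longleftrightarrow> (\<forall>u\<in>U. Poly_Mapping.lookup b u = 0)" for b
      by (auto simp: meets_def in_keys_iff)
    have add: "Poly_Mapping.lookup (b + a) = (\<lambda>v. Poly_Mapping.lookup a v + Poly_Mapping.lookup b v)" for b
      by (auto simp: lookup_add)
    have "Poly_Mapping.lookup (unit_exp u + a) =
        (Poly_Mapping.lookup a)(u := Suc (Poly_Mapping.lookup a u))" for u
      by (auto simp: lookup_add lookup_single when_def)
    moreover have "(\<forall>b. b \<notin> meets U \<longrightarrow> \<not> fits E k (Poly_Mapping.lookup (b + a))) \<longleftrightarrow>
        (\<forall>b. (\<forall>u\<in>U. b u = 0) \<longrightarrow> \<not> fits E k (\<lambda>v. Poly_Mapping.lookup a v + b v))"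
      unfolding off add
      by (rule all_lookup_iff[of "\<lambda>b. (\<forall>u\<in>U. b u = 0) \<longrightarrow>
        \<not> fits E k (\<lambda>v. Poly_Mapping.lookup a v + b v)"])
    ultimately show ?thesis by (simp add: colon_witness_def)
  qed
  then show ?thesis
    by (simp only: ex_lookup_iff[of ?W])
qed

theorem mainTheorem1:
  fixes G :: "'v::finite pair_pre_digraph" and U Z :: "'v set"
    and R :: "('v, 'k::field) mpoly ring" and I :: "('v, 'k) mpoly set"
  defines "R \<equiv> mpoly_ring" and "I \<equiv> edge_ideal G" and "Z \<equiv> pverts G - U"
  assumes "pair_graph G" and "pverts G = UNIV"
    and "Digraph_Component.connected (with_proj G)" and "\<not> bipartite G"
    and "U \<subseteq> pverts G"
  shows "var_prime U \<in> ass_primes R (ideal_power R I (astab R I)) \<longleftrightarrow>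
    coclique G Z \<and>
    (U = nbhd G Z \<or>
     U \<noteq> nbhd G Z \<and> (\<forall>C \<in> components (with_proj G \<restriction> (U - nbhd G Z)). has_odd_cycle C))"
proof -
  interpret pair_graph G by fact
  define E where "E = parcs G"
  have "sym E" using arcs_symmetric by (auto simp: E_def sym_def)
  \<comment> \<open>Without edges, all vertices on one side would form a bipartition.\<close>
  have "E \<noteq> {}"
    using \<open>\<not> bipartite G\<close> unfolding bipartite_def E_def by (metis Un_empty_right equals0D inf_bot_right)
  \<comment> \<open>This expresses that the prime of \<open>U\<close> is associated to the
    \<open>k\<close>-th power.\<close>
  define fitting where "fitting k U \<longleftrightarrow>
    (\<exists>a. (\<forall>b. (\<forall>u\<in>U. b u = 0) \<longrightarrow> \<not> fits E k (\<lambda>v. a v + b v)) \<and> (\<forall>u\<in>U. fits E k (a(u := Suc (a u)))))"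
    for k U
  \<comment> \<open>The condition of the theorem, with odd closed walks for odd cycles. If
    \<open>U = N(Z)\<close>, the second clause is vacuous.\<close>
  define odd_comps where "odd_comps U \<longleftrightarrow> Restr E (- U) = {} \<and>
    (\<forall>w \<in> U - E `` (- U). \<exists>n. odd n \<and> (w, w) \<in> Restr E (U - E `` (- U)) ^^ n)" for U
  have ass: "ass_primes R (ideal_power R I k) = var_prime ` {U. fitting k U}" for k
    unfolding R_def I_def ideal_power_edge_ideal ass_primes_mon_ideal[OF up_closed_fits]
      colon_witness_fits_iff fitting_def E_def ..
  have only_if: "odd_comps U" if fitting: "fitting k U" for k U
  proof -
    obtain a where a: "(\<forall>b. (\<forall>u\<in>U. b u = 0) \<longrightarrow> \<not> fits E k (\<lambda>v. a v + b v)) \<and>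
        (\<forall>u\<in>U. fits E k (a(u := Suc (a u))))"
      using fitting unfolding fitting_def by (rule exE)
    have "(x, y) \<notin> E" if "x \<notin> U" "y \<notin> U" for x y
    proof
      assume "(x, y) \<in> E"
      \<comment> \<open>Raised by the degrees of \<open>k\<close> copies of an edge outside
        \<open>U\<close>, \<open>a\<close> admits \<open>k\<close> edges, which is excluded.\<close>
      define b where "b = edge_deg (replicate_mset k (x, y))"
      have "fits E k (\<lambda>v. a v + b v)"
        using fitsI[of "replicate_mset k (x, y)" E] \<open>(x, y) \<in> E\<close> by (auto simp: b_def)
      moreover have "b u = 0" if "u \<in> U" for u
        using that \<open>x \<notin> U\<close> \<open>y \<notin> U\<close> unfolding b_def by (induction k) auto
      ultimately show False using a by blast
    qed
    moreover have "\<exists>n. odd n \<and> (w, w) \<in> Restr E (U - E `` (- U)) ^^ n"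
      if "w \<in> U - E `` (- U)" for w
    proof (rule odd_closed_walk_if_increments[OF \<open>sym E\<close> refl _ _ that])
      show "\<not> fits E k (\<lambda>v. a v + b v)" if "\<And>u. u \<in> U \<Longrightarrow> b u = 0" for b
        using a that by simp
      show "fits E k (a(u := Suc (a u)))" if "u \<in> U" for u
        using a that by simp
    qed
    ultimately show ?thesis
      unfolding odd_comps_def by blast
  qed
  have if': "\<exists>k0. \<forall>k\<ge>k0. fitting k U" if "odd_comps U" for U
    unfolding fitting_def
  proof (rule increments_if_odd_closed_walks[OF \<open>sym E\<close> \<open>E \<noteq> {}\<close> _ refl])
    show "Restr E (- U) = {}"
      using that by (simp add: odd_comps_def)
    show "\<exists>n. odd n \<and> (w, w) \<in> Restr E (U - E `` (- U)) ^^ n" if "w \<in> U - E `` (- U)" for w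
      using \<open>odd_comps U\<close> that by (simp add: odd_comps_def)
  qed
  obtain k0 where k0: "\<And>U k. odd_comps U \<Longrightarrow> k0 U \<le> k \<Longrightarrow> fitting k U"
    using if' by metis
  \<comment> \<open>There are only finitely many sets \<open>U\<close>, so one bound serves for all
    of them.\<close>
  define K where "K = Max (range k0)"
  have stable: "fitting k U \<longleftrightarrow> odd_comps U" if "K \<le> k" for k U
    using only_if k0[of U k] that Max_ge[of "range k0" "k0 U"] by (auto simp: K_def)
  have stable_ass: "ass_primes R (ideal_power R I k) = var_prime ` {U. odd_comps U}" if "K \<le> k" for k
    by (simp only: ass stable[OF that])
  \<comment> \<open>\<open>Suc K\<close> satisfies the condition in \<open>astab\<close>, hence so
    does the least such number; the successor makes it positive.\<close>
  have "1 \<le> Suc K \<and> (\<forall>i. ass_primes R (ideal_power R I (Suc K)) = ass_primes R (ideal_power R I (Suc K + i)))"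
    by (intro conjI allI, simp, subst (1 2) stable_ass) simp_all
  then have "1 \<le> astab R I \<and>
    (\<forall>i. ass_primes R (ideal_power R I (astab R I)) = ass_primes R (ideal_power R I (astab R I + i)))"
    unfolding astab_def by (rule LeastI)
  \<comment> \<open>The set is constant from \<open>astab\<close> on, so it can be read off at an
    exponent known to be at least \<open>K\<close>.\<close>
  then have "ass_primes R (ideal_power R I (astab R I)) = ass_primes R (ideal_power R I (astab R I + K))"
    by blast
  also have "\<dots> = var_prime ` {U. odd_comps U}"
    by (rule stable_ass) simp
  finally have lhs: "var_prime U \<in> ass_primes R (ideal_power R I (astab R I)) \<longleftrightarrow> odd_comps U"
    by auto
  have Z: "Z = - U" and nbhd: "nbhd G (- U) = E `` (- U)"
    using \<open>pverts G = UNIV\<close> by (auto simp: Z_def nbhd_def E_def)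
  have coclique: "coclique G Z \<longleftrightarrow> Restr E (- U) = {}"
    using \<open>pverts G = UNIV\<close> by (auto simp: coclique_def E_def Z)
  show ?thesis
  proof (cases "U = nbhd G Z")
    case True
    then have empty: "U - E `` (- U) = {}" unfolding Z nbhd by blast
    show ?thesis unfolding lhs coclique odd_comps_def empty using True by blast
  next
    case False
    have "(\<forall>C \<in> components (with_proj G \<restriction> (U - nbhd G Z)). has_odd_cycle C) \<longleftrightarrow>
      (\<forall>w \<in> U - E `` (- U). \<exists>n. odd n \<and> (w, w) \<in> Restr E (U - E `` (- U)) ^^ n)"
      unfolding Z nbhd E_def
      by (rule components_have_odd_cycle_iff[OF \<open>pair_graph G\<close>]) (simp add: \<open>pverts G = UNIV\<close>)
    with False show ?thesis unfolding lhs coclique odd_comps_def by simp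
  qed
qed

end
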